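(* Let $(M,g,\xi,\lambda)$ be an $n$-dimensional connected Yamabe soliton with scalar curvature $R$. Suppose the soliton field $\xi$ is a $\varphi$-analytic vector field of constant type-$c$ with $c<0$, and that $$\lambda\le R\le -n(n-1)c\quad\text{on } M.$$ Then $g$ is a Yamabe metric, i.e. $R$ is constant on $M$.
   Context: A Yamabe soliton $(M,g,\xi,\lambda)$ is a connected smooth Riemannian manifold $(M,g)$ together with a smooth vector field $\xi$ (the soliton field) and a constant $\lambda\in\mathbb{R}$ such that $\frac12\mathcal{L}_\xi g=(R-\lambda)g$, where $\mathcal{L}_\xi$ is the Lie derivative and $R$ is the scalar curvature of $g$. No compactness or completeness is assumed. The metric $g$ is called a Yamabe metric if $R$ is constant. Let $\eta$ be the $1$-form dual to $\xi$, $\eta(X)=g(X,\xi)$, and let $\varphi$ be the skew-symmetric $(1,1)$-tensor field defined by $\frac12 d\eta(X,Y)=g(\varphi X,Y)$, where $d\eta(X,Y)=X(\eta(Y))-Y(\eta(X))-\eta([X,Y])$; with $\nabla$ the Levi-Civita connection one then has $\nabla_X\xi=(R-\lambda)X+\varphi X$. The soliton field $\xi$ is called $\varphi$-analytic if $\varphi$ is invariant under the local flow of $\xi$, i.e. $\mathcal{L}_\xi\varphi=0$. It is called $\varphi$-analytic of constant type-$c$, for a constant $c\in\mathbb{R}$, if it is $\varphi$-analytic and $\nabla R=c\,\xi$, where $\nabla R$ is the gradient of $R$. *)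

theory Defs
  imports "HOL-Analysis.Analysis"
begin

section \<open>Smooth functions on open subsets of a Euclidean space\<close>

primrec Ck_on :: "nat \<Rightarrow> 'a::euclidean_space set \<Rightarrow> ('a \<Rightarrow> 'b::real_normed_vector) \<Rightarrow> bool" where
  "Ck_on 0 S f \<longleftrightarrow> continuous_on S f"
| "Ck_on (Suc k) S f \<longleftrightarrow>
     (\<forall>x\<in>S. f differentiable (at x)) \<and>
     (\<forall>v. Ck_on k S (\<lambda>x. frechet_derivative f (at x) v))"

definition smooth_on :: "'a::euclidean_space set \<Rightarrow> ('a \<Rightarrow> 'b::real_normed_vector) \<Rightarrow> bool" where
  "smooth_on S f \<longleftrightarrow> (\<forall>k. Ck_on k S f)"

section \<open>Smooth manifolds, tangent vectors and vector fields\<close>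

text \<open>
  A chart is a pair of a domain and a coordinate map; the values of the coordinate map outside the
  domain are irrelevant. The dimension of the manifold is the cardinality of the index type.

  A tangent vector at a point is the family of its coordinate columns in all charts around the
  point, related by the differentials of the coordinate changes. The columns belonging to the
  remaining charts are set to 0, so that the tangent space is a real vector space of dimension
  \<open>n\<close> under the pointwise operations.
\<close>

type_synonym ('a, 'n) chart = "'a set \<times> ('a \<Rightarrow> real ^ 'n)"
type_synonym ('a, 'n) tvec = "('a, 'n) chart \<Rightarrow> real ^ 'n"
type_synonym ('a, 'n) vfield = "'a \<Rightarrow> ('a, 'n) tvec"

abbreviation chart_inv :: "('a, 'n) chart \<Rightarrow> real ^ 'n \<Rightarrow> 'a" where
  "chart_inv c \<equiv> inv_into (fst c) (snd c)"

definition is_chart :: "'a topology \<Rightarrow> ('a, 'n::finite) chart \<Rightarrow> bool" where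
  "is_chart M c \<longleftrightarrow>
     openin M (fst c) \<and> open (snd c ` fst c) \<and>
     homeomorphic_map (subtopology M (fst c)) (top_of_set (snd c ` fst c)) (snd c)"

text \<open>The differential, at \<open>p\<close>, of the change of coordinates from \<open>c\<close> to \<open>d\<close>.\<close>

definition transition_deriv ::
  "('a, 'n::finite) chart \<Rightarrow> ('a, 'n) chart \<Rightarrow> 'a \<Rightarrow> real ^ 'n \<Rightarrow> real ^ 'n" where
  "transition_deriv c d p = frechet_derivative (snd d \<circ> chart_inv c) (at (snd c p))"

locale smooth_manifold =
  fixes M :: "'a topology" and A :: "('a, 'n::finite) chart set"
  assumes hausdorff: "Hausdorff_space M"
    and second_countable: "second_countable M"
    and charts: "\<And>c. c \<in> A \<Longrightarrow> is_chart M c"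
    and cover: "(\<Union>c\<in>A. fst c) = topspace M"
    and compatible: "\<And>c d. c \<in> A \<Longrightarrow> d \<in> A \<Longrightarrow>
      smooth_on (snd c ` (fst c \<inter> fst d)) (snd d \<circ> chart_inv c)"
begin

definition charts_at :: "'a \<Rightarrow> ('a, 'n) chart set" where
  "charts_at p = {c \<in> A. p \<in> fst c}"

definition chart_at :: "'a \<Rightarrow> ('a, 'n) chart" where
  "chart_at p = (SOME c. c \<in> charts_at p)"

definition tangent_space :: "'a \<Rightarrow> ('a, 'n) tvec set" where
  "tangent_space p =
     {v. (\<forall>c\<in>charts_at p. \<forall>d\<in>charts_at p. v d = transition_deriv c d p (v c)) \<and>
         (\<forall>c. c \<notin> charts_at p \<longrightarrow> v c = 0)}"

definition smooth_fun :: "'a set \<Rightarrow> ('a \<Rightarrow> real) \<Rightarrow> bool" where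
  "smooth_fun W f \<longleftrightarrow> (\<forall>c\<in>A. smooth_on (snd c ` (fst c \<inter> W)) (f \<circ> chart_inv c))"

text \<open>Smooth vector fields on an open set \<open>W\<close>; their values outside \<open>W\<close> are irrelevant.\<close>

definition vector_field :: "'a set \<Rightarrow> ('a, 'n) vfield \<Rightarrow> bool" where
  "vector_field W X \<longleftrightarrow>
     (\<forall>p\<in>W. X p \<in> tangent_space p) \<and>
     (\<forall>c\<in>A. smooth_on (snd c ` (fst c \<inter> W)) (\<lambda>x. X (chart_inv c x) c))"

text \<open>
  The derivative \<open>v(f)\<close> of a function along a tangent vector \<open>v\<close> at \<open>p\<close>. By the chain rule it
  does not depend on the chart used to compute it.
\<close>

definition dir_deriv :: "'a \<Rightarrow> ('a, 'n) tvec \<Rightarrow> ('a \<Rightarrow> real) \<Rightarrow> real" where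
  "dir_deriv p v f =
     (let c = chart_at p in frechet_derivative (f \<circ> chart_inv c) (at (snd c p)) (v c))"

definition vf_apply :: "('a, 'n) vfield \<Rightarrow> ('a \<Rightarrow> real) \<Rightarrow> 'a \<Rightarrow> real" where
  "vf_apply X f p = dir_deriv p (X p) f"

text \<open>In every chart, \<open>[X,Y]\<^sup>i = X\<^sup>j \<partial>\<^sub>j Y\<^sup>i - Y\<^sup>j \<partial>\<^sub>j X\<^sup>i\<close>.\<close>

definition lie_bracket :: "('a, 'n) vfield \<Rightarrow> ('a, 'n) vfield \<Rightarrow> ('a, 'n) vfield" where
  "lie_bracket X Y p c =
     (if c \<in> charts_at p then
        frechet_derivative (\<lambda>x. Y (chart_inv c x) c) (at (snd c p)) (X p c)
        - frechet_derivative (\<lambda>x. X (chart_inv c x) c) (at (snd c p)) (Y p c)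
      else 0)"

text \<open>The coordinate vector field \<open>\<partial>\<^sub>i\<close> of the chart \<open>c\<close>, a vector field on the domain of \<open>c\<close>.\<close>

definition coord_field :: "('a, 'n) chart \<Rightarrow> 'n \<Rightarrow> ('a, 'n) vfield" where
  "coord_field c i p d =
     (if c \<in> charts_at p \<and> d \<in> charts_at p then transition_deriv c d p (axis i 1) else 0)"

end

section \<open>Riemannian metrics and curvature\<close>

locale riemannian_manifold = smooth_manifold M A
  for M :: "'a topology" and A :: "('a, 'n::finite) chart set" +
  fixes g :: "'a \<Rightarrow> ('a, 'n) tvec \<Rightarrow> ('a, 'n) tvec \<Rightarrow> real"
  assumes metric_linear: "\<And>p u v w a b. p \<in> topspace M \<Longrightarrow>
      u \<in> tangent_space p \<Longrightarrow> v \<in> tangent_space p \<Longrightarrow> w \<in> tangent_space p \<Longrightarrow>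
      g p (\<lambda>c. a *\<^sub>R u c + b *\<^sub>R v c) w = a * g p u w + b * g p v w"
    and metric_sym: "\<And>p v w. p \<in> topspace M \<Longrightarrow>
      v \<in> tangent_space p \<Longrightarrow> w \<in> tangent_space p \<Longrightarrow> g p v w = g p w v"
    and metric_pos: "\<And>p v. p \<in> topspace M \<Longrightarrow>
      v \<in> tangent_space p \<Longrightarrow> v \<noteq> (\<lambda>c. 0) \<Longrightarrow> g p v v > 0"
    and metric_smooth: "\<And>W X Y. openin M W \<Longrightarrow> vector_field W X \<Longrightarrow> vector_field W Y \<Longrightarrow>
      smooth_fun W (\<lambda>p. g p (X p) (Y p))"
begin

definition inner_vf :: "('a, 'n) vfield \<Rightarrow> ('a, 'n) vfield \<Rightarrow> 'a \<Rightarrow> real" where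
  "inner_vf X Y p = g p (X p) (Y p)"

text \<open>
  Connections act on vector fields defined on arbitrary open subsets of the manifold. On every
  open set the conditions below determine \<open>D X Y\<close> by the Koszul formula.
\<close>

definition affine_connection :: "(('a, 'n) vfield \<Rightarrow> ('a, 'n) vfield \<Rightarrow> ('a, 'n) vfield) \<Rightarrow> bool" where
  "affine_connection D \<longleftrightarrow>
     (\<forall>W X Y Z f. openin M W \<and> vector_field W X \<and> vector_field W Y \<and> vector_field W Z \<and>
        smooth_fun W f \<longrightarrow>
        vector_field W (D X Y) \<and>
        (\<forall>p\<in>W.
           D (\<lambda>q c. f q *\<^sub>R X q c + Y q c) Z p = (\<lambda>c. f p *\<^sub>R D X Z p c + D Y Z p c) \<and>
           D X (\<lambda>q c. f q *\<^sub>R Y q c + Z q c) p =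
             (\<lambda>c. vf_apply X f p *\<^sub>R Y p c + f p *\<^sub>R D X Y p c + D X Z p c)))"

definition levi_civita_connection ::
  "(('a, 'n) vfield \<Rightarrow> ('a, 'n) vfield \<Rightarrow> ('a, 'n) vfield) \<Rightarrow> bool" where
  "levi_civita_connection D \<longleftrightarrow>
     affine_connection D \<and>
     (\<forall>W X Y Z. openin M W \<and> vector_field W X \<and> vector_field W Y \<and> vector_field W Z \<longrightarrow>
        (\<forall>p\<in>W.
           (\<lambda>c. D X Y p c - D Y X p c) = lie_bracket X Y p \<and>
           vf_apply X (inner_vf Y Z) p = inner_vf (D X Y) Z p + inner_vf Y (D X Z) p))"

definition nabla :: "('a, 'n) vfield \<Rightarrow> ('a, 'n) vfield \<Rightarrow> ('a, 'n) vfield" where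
  "nabla = (SOME D. levi_civita_connection D)"

definition riemann ::
  "('a, 'n) vfield \<Rightarrow> ('a, 'n) vfield \<Rightarrow> ('a, 'n) vfield \<Rightarrow> ('a, 'n) vfield" where
  "riemann X Y Z p c =
     nabla X (nabla Y Z) p c - nabla Y (nabla X Z) p c - nabla (lie_bracket X Y) Z p c"

text \<open>\<open>Ric(Y,Z)\<close> is the trace of the endomorphism \<open>V \<mapsto> riemann V Y Z\<close> of the tangent space.\<close>

definition ricci :: "('a, 'n) vfield \<Rightarrow> ('a, 'n) vfield \<Rightarrow> 'a \<Rightarrow> real" where
  "ricci Y Z p =
     (let c = chart_at p in \<Sum>i\<in>UNIV. riemann (coord_field c i) Y Z p c $ i)"

definition gram_matrix :: "('a, 'n) chart \<Rightarrow> 'a \<Rightarrow> real ^ 'n ^ 'n" where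
  "gram_matrix c p = (\<chi> j k. inner_vf (coord_field c j) (coord_field c k) p)"

definition scalar_curvature :: "'a \<Rightarrow> real" where
  "scalar_curvature p =
     (let c = chart_at p in
      \<Sum>j\<in>UNIV. \<Sum>k\<in>UNIV.
        matrix_inv (gram_matrix c p) $ j $ k * ricci (coord_field c j) (coord_field c k) p)"

definition gradient :: "('a \<Rightarrow> real) \<Rightarrow> ('a, 'n) vfield" where
  "gradient f p =
     (THE w. w \<in> tangent_space p \<and> (\<forall>v\<in>tangent_space p. g p w v = dir_deriv p v f))"

text \<open>\<open>lie_deriv_metric \<xi> X Y\<close> is \<open>(L\<^sub>\<xi> g)(X,Y)\<close>.\<close>

definition lie_deriv_metric ::
  "('a, 'n) vfield \<Rightarrow> ('a, 'n) vfield \<Rightarrow> ('a, 'n) vfield \<Rightarrow> 'a \<Rightarrow> real" where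
  "lie_deriv_metric \<xi> X Y p =
     vf_apply \<xi> (inner_vf X Y) p
     - inner_vf (lie_bracket \<xi> X) Y p - inner_vf X (lie_bracket \<xi> Y) p"

definition yamabe_metric :: bool where
  "yamabe_metric \<longleftrightarrow> (\<exists>k. \<forall>p\<in>topspace M. scalar_curvature p = k)"

end

section \<open>Yamabe solitons\<close>

locale yamabe_soliton = riemannian_manifold M A g
  for M :: "'a topology" and A :: "('a, 'n::finite) chart set"
    and g :: "'a \<Rightarrow> ('a, 'n) tvec \<Rightarrow> ('a, 'n) tvec \<Rightarrow> real" +
  fixes \<xi> :: "('a, 'n) vfield" and lam :: real
  assumes connected: "connected_space M"
    and soliton_field: "vector_field (topspace M) \<xi>"
    and soliton_eq: "\<And>W X Y p. openin M W \<Longrightarrow> vector_field W X \<Longrightarrow> vector_field W Y \<Longrightarrow> p \<in> W \<Longrightarrow>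
      1 / 2 * lie_deriv_metric \<xi> X Y p = (scalar_curvature p - lam) * inner_vf X Y p"
begin

definition eta :: "('a, 'n) vfield \<Rightarrow> 'a \<Rightarrow> real" where
  "eta X p = inner_vf X \<xi> p"

definition d_eta :: "('a, 'n) vfield \<Rightarrow> ('a, 'n) vfield \<Rightarrow> 'a \<Rightarrow> real" where
  "d_eta X Y p = vf_apply X (eta Y) p - vf_apply Y (eta X) p - eta (lie_bracket X Y) p"

text \<open>
  The tensor field \<open>\<phi>\<close> with \<open>1/2 d\<eta>(X,Y) = g(\<phi>X,Y)\<close>, as an endomorphism of each tangent space:
  \<open>phi p v\<close> is \<open>(\<phi>X)\<^sub>p\<close> for any local vector field \<open>X\<close> with value \<open>v\<close> at \<open>p\<close>.
\<close>

definition phi :: "'a \<Rightarrow> ('a, 'n) tvec \<Rightarrow> ('a, 'n) tvec" where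
  "phi p v =
     (THE w. w \<in> tangent_space p \<and>
        (\<forall>W X Y. openin M W \<and> p \<in> W \<and> vector_field W X \<and> vector_field W Y \<and> X p = v \<longrightarrow>
           1 / 2 * d_eta X Y p = g p w (Y p)))"

definition phi_vf :: "('a, 'n) vfield \<Rightarrow> ('a, 'n) vfield" where
  "phi_vf X p = phi p (X p)"

text \<open>\<open>lie_deriv_phi X\<close> is \<open>(L\<^sub>\<xi> \<phi>) X\<close>.\<close>

definition lie_deriv_phi :: "('a, 'n) vfield \<Rightarrow> ('a, 'n) vfield" where
  "lie_deriv_phi X p c = lie_bracket \<xi> (phi_vf X) p c - phi_vf (lie_bracket \<xi> X) p c"

definition phi_analytic :: bool where
  "phi_analytic \<longleftrightarrow>
     (\<forall>W X p. openin M W \<and> vector_field W X \<and> p \<in> W \<longrightarrow> lie_deriv_phi X p = (\<lambda>c. 0))"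

definition phi_analytic_of_type :: "real \<Rightarrow> bool" where
  "phi_analytic_of_type k \<longleftrightarrow>
     phi_analytic \<and>
     (\<forall>p\<in>topspace M. gradient scalar_curvature p = (\<lambda>c. k *\<^sub>R \<xi> p c))"

end

end

theory Submission
  imports Defs
begin

text \<open>
  Write \<open>R\<close> for the scalar curvature, \<open>n\<close> for the dimension and \<open>f = R - \<lambda>\<close>, and let \<open>\<eta>\<close> be the form
  dual to the soliton field \<open>\<xi>\<close>. As \<open>dR = c \<eta>\<close> with \<open>c \<noteq> 0\<close>, the form \<open>\<eta>\<close> is closed, so that
  \<open>\<phi> = 0\<close> and the soliton equation becomes \<open>\<nabla>\<^sub>X \<xi> = f X\<close>. A second differentiation gives
  \<open>Riem(X,Y)\<xi> = c (\<eta>(X) Y - \<eta>(Y) X)\<close>, and the pair symmetry of the curvature turns this into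
  \<open>Riem(X,\<xi>)Y = c (g(X,Y) \<xi> - \<eta>(Y) X)\<close>. In the second Bianchi identity for the directions \<open>\<xi>, X, Y\<close>,
  two of the three terms differentiate a curvature with \<open>\<xi>\<close> among its arguments and are therefore
  known, and what remains is
  \<open>(\<nabla>\<^sub>\<xi> Riem)(X,Y)Z = 2 c f (g(X,Z) Y - g(Y,Z) X) - 2 f Riem(X,Y)Z\<close>.
  Two traces yield \<open>\<xi>(R) = - 2 f (R + n (n - 1) c)\<close>, and the left-hand side is \<open>c |\<xi>|\<^sup>2\<close>. The bounds
  on \<open>R\<close> make the right-hand side nonnegative, whereas \<open>c |\<xi>|\<^sup>2 \<le> 0\<close> because \<open>c < 0\<close>. Hence \<open>\<xi> = 0\<close>
  everywhere, \<open>dR = 0\<close>, and \<open>R\<close> is constant on the connected manifold.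

  The identity for \<open>\<xi>(R)\<close> is a computation in a single chart, carried out in \<open>dScal_xi\<close> for a metric
  on an open subset of a Euclidean space, where \<open>\<nabla>\<^sub>u\<close> is a directional derivative plus a Christoffel
  symbol. Two facts are needed to bring it to the manifold. The connection \<open>nabla\<close> is introduced by a
  choice among all Levi-Civita connections, so that its coordinate expression rests on the existence
  (\<open>levi_civita_conn\<close>) and the uniqueness (\<open>levi_civita_unique\<close>) of such a connection. And the scalar
  curvature at a point is defined through a chart selected for that point; it can be differentiated
  only because every other chart gives the same value (\<open>scalar_curvature_chart\<close>).
\<close>

section \<open>Calculus of smooth functions\<close>

abbreviation fderiv :: "('a::real_normed_vector \<Rightarrow> 'b::real_normed_vector) \<Rightarrow> 'a \<Rightarrow> 'a \<Rightarrow> 'b" where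
  "fderiv f x \<equiv> frechet_derivative f (at x)"

lemma fderiv_eqI: "(f has_derivative f') (at x) \<Longrightarrow> fderiv f x = f'"
  by (metis frechet_derivative_at)

lemma has_fderiv: "f differentiable (at x) \<Longrightarrow> (f has_derivative fderiv f x) (at x)"
  by (simp add: frechet_derivative_works)

lemma fderiv_cong_open:
  assumes "open S" "x \<in> S" "\<And>y. y \<in> S \<Longrightarrow> f y = g y" "f differentiable (at x)"
  shows "fderiv g x = fderiv f x" "g differentiable (at x)"
proof -
  have "(g has_derivative fderiv f x) (at x)"
    by (rule has_derivative_transform_within_open[OF has_fderiv[OF assms(4)] assms(1,2,3)])
  then show "fderiv g x = fderiv f x" "g differentiable (at x)"
    by (auto intro: fderiv_eqI simp: differentiable_def)
qed

lemma Ck_on_cong: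
  assumes "open S"
  shows "Ck_on k S f \<Longrightarrow> (\<And>x. x \<in> S \<Longrightarrow> f x = g x) \<Longrightarrow> Ck_on k S g"
proof (induction k arbitrary: f g)
  case 0
  then show ?case by (simp cong: continuous_on_cong)
next
  case (Suc k)
  have *: "fderiv g x = fderiv f x" "g differentiable (at x)" if "x \<in> S" for x
    using fderiv_cong_open[OF assms that, of f g] Suc.prems that by auto
  have "Ck_on k S (\<lambda>x. fderiv g x v)" for v
    by (rule Suc.IH[of "\<lambda>x. fderiv f x v"]) (use Suc.prems * in auto)
  then show ?case using * by simp
qed

lemma Ck_on_Suc_imp: "Ck_on (Suc k) S f \<Longrightarrow> Ck_on k S f"
proof (induction k arbitrary: f)
  case 0
  then show ?case
    by (auto intro!: continuous_at_imp_continuous_on differentiable_imp_continuous_within)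
qed auto

lemma Ck_on_subset: "Ck_on k S f \<Longrightarrow> T \<subseteq> S \<Longrightarrow> Ck_on k T f"
  by (induction k arbitrary: f) (auto intro: continuous_on_subset)

text \<open>
  Closure under sums, products, composition and inversion is proved by induction on the order of
  differentiability, and this rule is the induction step. It asks for the derivative on the open set only, because the
  values of \<open>frechet_derivative\<close> elsewhere carry no information.
\<close>

lemma Ck_on_SucI:
  assumes "open S" "\<And>x. x \<in> S \<Longrightarrow> (f has_derivative f' x) (at x)"
    "\<And>v. Ck_on k S (\<lambda>x. f' x v)"
  shows "Ck_on (Suc k) S f"
proof -
  have "Ck_on k S (\<lambda>x. fderiv f x v)" for v
    by (rule Ck_on_cong[OF assms(1) assms(3)[of v]]) (simp add: fderiv_eqI[OF assms(2)])
  then show ?thesis using assms(2) by (auto simp: differentiable_def)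
qed

lemma Ck_on_SucD:
  assumes "Ck_on (Suc k) S f"
  shows "\<And>x. x \<in> S \<Longrightarrow> (f has_derivative fderiv f x) (at x)" "\<And>v. Ck_on k S (\<lambda>x. fderiv f x v)"
  using assms by (auto intro: has_fderiv)

lemma Ck_on_const: "open S \<Longrightarrow> Ck_on k S (\<lambda>x. a)"
  by (induction k arbitrary: a) simp_all

lemma Ck_on_linear:
  assumes "open S" "bounded_linear L"
  shows "Ck_on k S f \<Longrightarrow> Ck_on k S (\<lambda>x. L (f x))"
proof (induction k arbitrary: f)
  case 0
  then show ?case by (simp add: bounded_linear.continuous_on[OF assms(2)])
next
  case (Suc k)
  note D = Ck_on_SucD[OF Suc.prems]
  show ?case
    by (rule Ck_on_SucI[OF assms(1) bounded_linear.has_derivative[OF assms(2) D(1)] Suc.IH[OF D(2)]])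
qed

lemma Ck_on_add:
  assumes "open S"
  shows "Ck_on k S f \<Longrightarrow> Ck_on k S g \<Longrightarrow> Ck_on k S (\<lambda>x. f x + g x)"
proof (induction k arbitrary: f g)
  case 0
  then show ?case by (simp add: continuous_on_add)
next
  case (Suc k)
  note D = Ck_on_SucD[OF Suc.prems(1)] Ck_on_SucD[OF Suc.prems(2)]
  show ?case
    by (rule Ck_on_SucI[OF assms has_derivative_add[OF D(1,3)] Suc.IH[OF D(2,4)]])
qed

lemma Ck_on_bilinear:
  assumes "open S" "bounded_bilinear h"
  shows "Ck_on k S f \<Longrightarrow> Ck_on k S g \<Longrightarrow> Ck_on k S (\<lambda>x. h (f x) (g x))"
proof (induction k arbitrary: f g)
  case 0
  then show ?case by (simp add: bounded_bilinear.continuous_on[OF assms(2)])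
next
  case (Suc k)
  note D = Ck_on_SucD[OF Suc.prems(1)] Ck_on_SucD[OF Suc.prems(2)]
  have *: "Ck_on k S (\<lambda>x. h (f x) (fderiv g x v) + h (fderiv f x v) (g x))" for v
    by (intro Ck_on_add[OF assms(1)] Suc.IH D(2,4) Ck_on_Suc_imp[OF Suc.prems(1)]
        Ck_on_Suc_imp[OF Suc.prems(2)])
  show ?case
    by (rule Ck_on_SucI[OF assms(1) bounded_bilinear.FDERIV[OF assms(2) D(1,3)] *])
qed

lemma Ck_on_sum:
  assumes "open S" "\<And>i. i \<in> I \<Longrightarrow> Ck_on k S (f i)"
  shows "Ck_on k S (\<lambda>x. \<Sum>i\<in>I. f i x)"
proof (cases "finite I")
  case True
  then show ?thesis using assms(2)
    by (induction I) (auto intro: Ck_on_const Ck_on_add assms(1))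
next
  case False
  then show ?thesis by (simp add: Ck_on_const assms(1))
qed

text \<open>
  The chain rule \<open>D(g \<circ> f) v = \<Sum>b. (Df v \<bullet> b) (D\<^sub>b g \<circ> f)\<close>, with \<open>b\<close> ranging over the standard
  basis, presents the derivative through compositions of one order less.
\<close>

lemma Ck_on_compose:
  fixes f :: "'a::euclidean_space \<Rightarrow> 'b::euclidean_space"
  assumes "open S" "open T" "\<And>x. x \<in> S \<Longrightarrow> f x \<in> T"
  shows "Ck_on k S f \<Longrightarrow> Ck_on k T g \<Longrightarrow> Ck_on k S (\<lambda>x. g (f x))"
proof (induction k arbitrary: g)
  case 0
  then show ?case
    using continuous_on_compose2[of T g S f] assms(3) by auto
next
  case (Suc k)
  note D = Ck_on_SucD[OF Suc.prems(1)] Ck_on_SucD[OF Suc.prems(2)]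
  have "((\<lambda>x. g (f x)) has_derivative (\<lambda>v. \<Sum>b\<in>Basis. (fderiv f x v \<bullet> b) *\<^sub>R fderiv g (f x) b)) (at x)"
    if x: "x \<in> S" for x
  proof -
    have lin: "linear (fderiv g (f x))"
      using D(3) assms(3)[OF x] has_derivative_linear by blast
    have "fderiv g (f x) w = (\<Sum>b\<in>Basis. (w \<bullet> b) *\<^sub>R fderiv g (f x) b)" for w
      using linear_sum[OF lin, of "\<lambda>b. (w \<bullet> b) *\<^sub>R b" Basis]
      by (simp add: euclidean_representation linear_scale[OF lin])
    then have "(\<lambda>v. fderiv g (f x) (fderiv f x v)) =
        (\<lambda>v. \<Sum>b\<in>Basis. (fderiv f x v \<bullet> b) *\<^sub>R fderiv g (f x) b)"
      by (intro ext)
    then show ?thesis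
      by (rule subst) (rule has_derivative_compose[OF D(1)[OF x] D(3)[OF assms(3)[OF x]]])
  qed
  moreover have "Ck_on k S (\<lambda>x. \<Sum>b\<in>Basis. (fderiv f x v \<bullet> b) *\<^sub>R fderiv g (f x) b)" for v
    by (intro Ck_on_sum Ck_on_bilinear[OF assms(1) bounded_bilinear_scaleR]
        Ck_on_linear[OF assms(1) bounded_linear_inner_left] Suc.IH D(2,4) assms(1)
        Ck_on_Suc_imp[OF Suc.prems(1)])
  ultimately show ?case by (intro Ck_on_SucI assms(1))
qed

lemma Ck_on_inverse:
  fixes f :: "'a::euclidean_space \<Rightarrow> real"
  assumes "open S" "\<And>x. x \<in> S \<Longrightarrow> f x \<noteq> 0"
  shows "Ck_on k S f \<Longrightarrow> Ck_on k S (\<lambda>x. inverse (f x))"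
proof (induction k)
  case 0
  then show ?case using assms(2) by (simp add: continuous_on_inverse)
next
  case (Suc k)
  note D = Ck_on_SucD[OF Suc.prems(1)]
  have I: "Ck_on k S (\<lambda>x. inverse (f x))" by (rule Suc.IH[OF Ck_on_Suc_imp[OF Suc.prems]])
  have "((\<lambda>x. inverse (f x)) has_derivative
      (\<lambda>h. - (inverse (f x) * (fderiv f x h) * inverse (f x)))) (at x)" if "x \<in> S" for x
    using Deriv.has_derivative_inverse[OF assms(2)[OF that] D(1)[OF that]] .
  moreover have "Ck_on k S (\<lambda>x. - (inverse (f x) * (fderiv f x v) * inverse (f x)))" for v
    by (rule Ck_on_linear[OF assms(1) bounded_linear_minus[OF bounded_linear_ident]],
        intro Ck_on_bilinear[OF assms(1) bounded_bilinear_mult] I D(2))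
  ultimately show ?case by (rule Ck_on_SucI[OF assms(1)])
qed

subsection \<open>Smooth functions\<close>

lemma smooth_on_cong:
  "open S \<Longrightarrow> smooth_on S f \<Longrightarrow> (\<And>x. x \<in> S \<Longrightarrow> f x = g x) \<Longrightarrow> smooth_on S g"
  unfolding smooth_on_def using Ck_on_cong by blast

lemma smooth_on_subset: "smooth_on S f \<Longrightarrow> T \<subseteq> S \<Longrightarrow> smooth_on T f"
  unfolding smooth_on_def using Ck_on_subset by blast

lemma smooth_on_const: "open S \<Longrightarrow> smooth_on S (\<lambda>x. a)"
  by (simp add: smooth_on_def Ck_on_const)

lemma smooth_on_linear:
  "open S \<Longrightarrow> bounded_linear L \<Longrightarrow> smooth_on S f \<Longrightarrow> smooth_on S (\<lambda>x. L (f x))"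
  by (simp add: smooth_on_def Ck_on_linear)

lemma smooth_on_add:
  "open S \<Longrightarrow> smooth_on S f \<Longrightarrow> smooth_on S g \<Longrightarrow> smooth_on S (\<lambda>x. f x + g x)"
  by (simp add: smooth_on_def Ck_on_add)

lemma smooth_on_minus: "open S \<Longrightarrow> smooth_on S f \<Longrightarrow> smooth_on S (\<lambda>x. - f x)"
  by (rule smooth_on_linear[OF _ bounded_linear_minus[OF bounded_linear_ident]])

lemma smooth_on_diff:
  "open S \<Longrightarrow> smooth_on S f \<Longrightarrow> smooth_on S g \<Longrightarrow> smooth_on S (\<lambda>x. f x - g x)"
  using smooth_on_add[of S f "\<lambda>x. - g x"] smooth_on_minus[of S g] by simp

lemma smooth_on_scaleR:
  "open S \<Longrightarrow> smooth_on S f \<Longrightarrow> smooth_on S g \<Longrightarrow> smooth_on S (\<lambda>x. f x *\<^sub>R g x)"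
  by (simp add: smooth_on_def Ck_on_bilinear[OF _ bounded_bilinear_scaleR])

lemma smooth_on_mult:
  fixes f :: "'a::euclidean_space \<Rightarrow> real"
  shows "open S \<Longrightarrow> smooth_on S f \<Longrightarrow> smooth_on S g \<Longrightarrow> smooth_on S (\<lambda>x. f x * g x)"
  by (simp add: smooth_on_def Ck_on_bilinear[OF _ bounded_bilinear_mult])

lemma smooth_on_sum:
  "open S \<Longrightarrow> (\<And>i. i \<in> I \<Longrightarrow> smooth_on S (f i)) \<Longrightarrow> smooth_on S (\<lambda>x. \<Sum>i\<in>I. f i x)"
  by (simp add: smooth_on_def Ck_on_sum)

lemma smooth_on_prod:
  fixes f :: "'i \<Rightarrow> 'a::euclidean_space \<Rightarrow> real"
  assumes "open S" "\<And>i. i \<in> I \<Longrightarrow> smooth_on S (f i)"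
  shows "smooth_on S (\<lambda>x. \<Prod>i\<in>I. f i x)"
proof (cases "finite I")
  case True
  then show ?thesis using assms(2)
    by (induction I) (auto intro: smooth_on_const smooth_on_mult assms(1))
qed (simp add: smooth_on_const assms(1))

lemma smooth_on_compose:
  fixes f :: "'a::euclidean_space \<Rightarrow> 'b::euclidean_space"
  shows "open S \<Longrightarrow> open T \<Longrightarrow> (\<And>x. x \<in> S \<Longrightarrow> f x \<in> T) \<Longrightarrow> smooth_on S f \<Longrightarrow> smooth_on T g \<Longrightarrow>
    smooth_on S (\<lambda>x. g (f x))"
  by (simp add: smooth_on_def Ck_on_compose)

lemma smooth_on_divide:
  fixes f :: "'a::euclidean_space \<Rightarrow> real"
  assumes "open S" "smooth_on S f" "smooth_on S g" "\<And>x. x \<in> S \<Longrightarrow> g x \<noteq> 0"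
  shows "smooth_on S (\<lambda>x. f x / g x)"
proof -
  have "smooth_on S (\<lambda>x. inverse (g x))"
    using assms Ck_on_inverse[OF assms(1,4)] by (simp add: smooth_on_def)
  then show ?thesis
    using smooth_on_mult[OF assms(1,2)] by (simp add: divide_inverse)
qed

lemma smooth_on_fderiv: "smooth_on S f \<Longrightarrow> smooth_on S (\<lambda>x. fderiv f x v)"
  unfolding smooth_on_def by (metis Ck_on.simps(2))

lemma smooth_on_differentiable: "smooth_on S f \<Longrightarrow> x \<in> S \<Longrightarrow> f differentiable (at x)"
  unfolding smooth_on_def by (metis Ck_on.simps(2))

lemma smooth_on_has_fderiv: "smooth_on S f \<Longrightarrow> x \<in> S \<Longrightarrow> (f has_derivative fderiv f x) (at x)"
  by (intro has_fderiv smooth_on_differentiable)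

lemma smooth_on_linear_fderiv: "smooth_on S f \<Longrightarrow> x \<in> S \<Longrightarrow> linear (fderiv f x)"
  by (rule has_derivative_linear[OF smooth_on_has_fderiv])

lemma smooth_on_continuous_on: "smooth_on S f \<Longrightarrow> continuous_on S f"
  unfolding smooth_on_def by (metis Ck_on.simps(1))

lemma smooth_on_vec_nth: "open S \<Longrightarrow> smooth_on S f \<Longrightarrow> smooth_on S (\<lambda>x. f x $ i)"
  by (rule smooth_on_linear[OF _ bounded_linear_vec_nth])

lemma vec_axis_sum: "(v::real^'n) = (\<Sum>i\<in>UNIV. v $ i *\<^sub>R axis i 1)"
  using basis_expansion[of v] by (simp add: scalar_mult_eq_scaleR)

lemma smooth_on_vecI:
  fixes f :: "'a::euclidean_space \<Rightarrow> real ^ 'n"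
  assumes "open S" "\<And>i. smooth_on S (\<lambda>x. f x $ i)"
  shows "smooth_on S f"
proof -
  have "smooth_on S (\<lambda>x. \<Sum>i\<in>UNIV. f x $ i *\<^sub>R axis i (1::real))"
    by (intro smooth_on_sum smooth_on_scaleR smooth_on_const assms)
  then show ?thesis by (simp add: vec_axis_sum[symmetric])
qed

lemma smooth_on_det:
  fixes m :: "'a::euclidean_space \<Rightarrow> real ^ 'n ^ 'n"
  assumes "open S" "\<And>i j. smooth_on S (\<lambda>x. m x $ i $ j)"
  shows "smooth_on S (\<lambda>x. det (m x))"
  unfolding det_def by (intro smooth_on_sum smooth_on_mult smooth_on_prod smooth_on_const assms)

text \<open>Cramer's rule writes a solution of a linear system as a quotient of determinants.\<close>

lemma smooth_on_solve:
  fixes m :: "'a::euclidean_space \<Rightarrow> real ^ 'n ^ 'n" and b y :: "'a \<Rightarrow> real ^ 'n"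
  assumes "open S" "\<And>i j. smooth_on S (\<lambda>x. m x $ i $ j)" "\<And>i. smooth_on S (\<lambda>x. b x $ i)"
    and "\<And>x. x \<in> S \<Longrightarrow> det (m x) \<noteq> 0" and "\<And>x. x \<in> S \<Longrightarrow> m x *v y x = b x"
  shows "smooth_on S y"
proof (rule smooth_on_vecI[OF assms(1)])
  fix k
  have "smooth_on S (\<lambda>x. (\<chi> i j. if j = k then b x $ i else m x $ i $ j) $ i $ j)" for i j
    by (cases "j = k") (simp_all add: assms)
  then have "smooth_on S (\<lambda>x. det (\<chi> i j. if j = k then b x $ i else m x $ i $ j) / det (m x))"
    by (intro smooth_on_divide smooth_on_det assms)
  moreover have "y x $ k = det (\<chi> i j. if j = k then b x $ i else m x $ i $ j) / det (m x)"
    if "x \<in> S" for x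
    using cramer[OF assms(4)[OF that], of "y x" "b x"] assms(5)[OF that] by simp
  ultimately show "smooth_on S (\<lambda>x. y x $ k)"
    using smooth_on_cong[OF assms(1), of _ "\<lambda>x. y x $ k"] by simp
qed

subsection \<open>Symmetry of second derivatives\<close>

text \<open>
  The mean value theorem, applied in each of the two variables, represents the second difference
  \<open>f(x+hu+hv) - f(x+hu) - f(x+hv) + f(x)\<close> as a second derivative at an intermediate point.
\<close>

lemma second_difference_mvt:
  fixes f :: "'a::euclidean_space \<Rightarrow> real"
  assumes f: "smooth_on U f" and h: "0 < h"
    and sub: "\<And>s t. 0 \<le> s \<Longrightarrow> s \<le> h \<Longrightarrow> 0 \<le> t \<Longrightarrow> t \<le> h \<Longrightarrow> x + s *\<^sub>R u + t *\<^sub>R v \<in> U"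
  obtains s t where "0 < s" "s < h" "0 < t" "t < h"
    "f (x + h *\<^sub>R u + h *\<^sub>R v) - f (x + h *\<^sub>R u) - f (x + h *\<^sub>R v) + f x
     = h * h * fderiv (\<lambda>y. fderiv f y u) (x + s *\<^sub>R u + t *\<^sub>R v) v"
proof -
  have d1: "((\<lambda>s. F (x + s *\<^sub>R u + t *\<^sub>R v)) has_derivative
      (\<lambda>r. r * fderiv F (x + s *\<^sub>R u + t *\<^sub>R v) u)) (at s)"
    if "smooth_on U F" "0 \<le> s" "s \<le> h" "0 \<le> t" "t \<le> h" for s t and F :: "'a \<Rightarrow> real"
  proof -
    note F = smooth_on_has_fderiv[OF that(1) sub[OF that(2-5)]]
    have "((\<lambda>s. x + s *\<^sub>R u + t *\<^sub>R v) has_derivative (\<lambda>r. r *\<^sub>R u)) (at s)"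
      by (auto intro!: derivative_eq_intros)
    from has_derivative_compose[OF this F] show ?thesis
      by (simp add: linear_scale[OF has_derivative_linear[OF F]])
  qed
  have d2: "((\<lambda>t. F (x + s *\<^sub>R u + t *\<^sub>R v)) has_derivative
      (\<lambda>r. r * fderiv F (x + s *\<^sub>R u + t *\<^sub>R v) v)) (at t)"
    if "smooth_on U F" "0 \<le> s" "s \<le> h" "0 \<le> t" "t \<le> h" for s t and F :: "'a \<Rightarrow> real"
  proof -
    note F = smooth_on_has_fderiv[OF that(1) sub[OF that(2-5)]]
    have "((\<lambda>t. x + s *\<^sub>R u + t *\<^sub>R v) has_derivative (\<lambda>r. r *\<^sub>R v)) (at t)"
      by (auto intro!: derivative_eq_intros)
    from has_derivative_compose[OF this F] show ?thesis
      by (simp add: linear_scale[OF has_derivative_linear[OF F]])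
  qed
  define p where "p s = f (x + s *\<^sub>R u + h *\<^sub>R v) - f (x + s *\<^sub>R u + 0 *\<^sub>R v)" for s
  have "(p has_derivative (\<lambda>r. r * fderiv f (x + s *\<^sub>R u + h *\<^sub>R v) u - r * fderiv f (x + s *\<^sub>R u + 0 *\<^sub>R v) u))
      (at s)" if "0 \<le> s" "s \<le> h" for s
    unfolding p_def by (intro has_derivative_diff d1 f) (use that h in auto)
  then obtain s where s: "0 < s" "s < h"
    "p h - p 0 = h * (fderiv f (x + s *\<^sub>R u + h *\<^sub>R v) u - fderiv f (x + s *\<^sub>R u + 0 *\<^sub>R v) u)"
    using mvt_simple[OF h, of p "\<lambda>s r. r * fderiv f (x + s *\<^sub>R u + h *\<^sub>R v) u - r * fderiv f (x + s *\<^sub>R u + 0 *\<^sub>R v) u"]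
    by (auto simp: has_derivative_at_withinI algebra_simps)
  define q where "q t = fderiv f (x + s *\<^sub>R u + t *\<^sub>R v) u" for t
  have "(q has_derivative (\<lambda>r. r * fderiv (\<lambda>y. fderiv f y u) (x + s *\<^sub>R u + t *\<^sub>R v) v)) (at t)"
    if "0 \<le> t" "t \<le> h" for t
    unfolding q_def by (intro d2 smooth_on_fderiv f) (use that s in auto)
  then obtain t where t: "0 < t" "t < h"
    "q h - q 0 = h * fderiv (\<lambda>y. fderiv f y u) (x + s *\<^sub>R u + t *\<^sub>R v) v"
    using mvt_simple[OF h, of q "\<lambda>t r. r * fderiv (\<lambda>y. fderiv f y u) (x + s *\<^sub>R u + t *\<^sub>R v) v"]
    by (auto simp: has_derivative_at_withinI algebra_simps)
  show ?thesis
    by (rule that[OF s(1,2) t(1,2)]) (use s(3) t(3) in \<open>simp add: p_def q_def\<close>)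
qed

text \<open>
  The second difference is symmetric in \<open>u\<close> and \<open>v\<close>. Divided by \<open>h\<^sup>2\<close> it takes values of both mixed
  derivatives at points close to \<open>x\<close>, so that the two agree at \<open>x\<close> by continuity.
\<close>

lemma fderiv_commute_real:
  fixes f :: "'a::euclidean_space \<Rightarrow> real"
  assumes U: "open U" "x \<in> U" and f: "smooth_on U f"
  shows "fderiv (\<lambda>y. fderiv f y u) x v = fderiv (\<lambda>y. fderiv f y v) x u"
proof -
  define A where "A y = fderiv (\<lambda>y. fderiv f y u) y v" for y
  define B where "B y = fderiv (\<lambda>y. fderiv f y v) y u" for y
  have cont: "isCont A x" "isCont B x"
    unfolding A_def B_def using U
    by (auto intro!: continuous_on_interior[OF smooth_on_continuous_on] smooth_on_fderiv f simp: interior_open)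
  have "\<bar>A x - B x\<bar> < e" if e: "0 < e" for e
  proof -
    have "e/2 > 0" using e by simp
    then obtain d where d: "d > 0" "\<And>y. dist y x < d \<Longrightarrow> dist (A y) (A x) < e/2"
       "\<And>y. dist y x < d \<Longrightarrow> dist (B y) (B x) < e/2" "\<And>y. dist y x < d \<Longrightarrow> y \<in> U"
    proof -
      obtain d1 where "d1 > 0" "\<And>y. dist y x < d1 \<Longrightarrow> dist (A y) (A x) < e/2"
        using cont(1) \<open>e/2 > 0\<close> unfolding continuous_at_eps_delta by blast
      moreover obtain d2 where "d2 > 0" "\<And>y. dist y x < d2 \<Longrightarrow> dist (B y) (B x) < e/2"
        using cont(2) \<open>e/2 > 0\<close> unfolding continuous_at_eps_delta by blast
      moreover obtain d3 where "d3 > 0" "\<And>y. dist y x < d3 \<Longrightarrow> y \<in> U"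
        using U unfolding open_dist by blast
      ultimately show ?thesis using that[of "min d1 (min d2 d3)"] by auto
    qed
    define h where "h = d / (2 * (norm u + norm v + 1))"
    have h: "h > 0" using d(1) by (auto simp: h_def intro!: divide_pos_pos add_nonneg_pos)
    have near: "dist (x + s *\<^sub>R u + t *\<^sub>R v) x < d" if "0 \<le> s" "s \<le> h" "0 \<le> t" "t \<le> h" for s t
    proof -
      have "dist (x + s *\<^sub>R u + t *\<^sub>R v) x = norm (s *\<^sub>R u + t *\<^sub>R v)" by (simp add: dist_norm)
      also have "\<dots> \<le> s * norm u + t * norm v"
        by (rule norm_triangle_le) (use that in simp)
      also have "\<dots> \<le> h * norm u + h * norm v"
        by (intro add_mono mult_right_mono) (use that in auto)
      also have "\<dots> = d * ((norm u + norm v) / (2 * (norm u + norm v + 1)))"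
        by (simp add: h_def algebra_simps add_divide_distrib)
      also have "\<dots> < d * 1"
        by (intro mult_strict_left_mono d(1)) (smt (verit) norm_ge_zero divide_less_eq_1)
      finally show ?thesis by simp
    qed
    have nearU: "x + s *\<^sub>R u + t *\<^sub>R v \<in> U" if "0 \<le> s" "s \<le> h" "0 \<le> t" "t \<le> h" for s t
      using near[OF that] d(4) by simp
    obtain s t where st: "0 < s" "s < h" "0 < t" "t < h"
      "f (x + h *\<^sub>R u + h *\<^sub>R v) - f (x + h *\<^sub>R u) - f (x + h *\<^sub>R v) + f x
       = h * h * A (x + s *\<^sub>R u + t *\<^sub>R v)"
      using second_difference_mvt[OF f h nearU, folded A_def] by blast
    have nearU': "x + s *\<^sub>R v + t *\<^sub>R u \<in> U" if "0 \<le> s" "s \<le> h" "0 \<le> t" "t \<le> h" for s t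
      using nearU[OF that(3,4,1,2)] by (simp add: add.assoc add.commute add.left_commute)
    obtain s' t' where st': "0 < s'" "s' < h" "0 < t'" "t' < h"
      "f (x + h *\<^sub>R v + h *\<^sub>R u) - f (x + h *\<^sub>R v) - f (x + h *\<^sub>R u) + f x
       = h * h * B (x + s' *\<^sub>R v + t' *\<^sub>R u)"
      using second_difference_mvt[OF f h nearU', folded B_def] by blast
    have "h * h * A (x + s *\<^sub>R u + t *\<^sub>R v) = h * h * B (x + t' *\<^sub>R u + s' *\<^sub>R v)"
      using st(5) st'(5) by (simp add: algebra_simps)
    then have "A (x + s *\<^sub>R u + t *\<^sub>R v) = B (x + t' *\<^sub>R u + s' *\<^sub>R v)" using h by simp
    moreover have "dist (A (x + s *\<^sub>R u + t *\<^sub>R v)) (A x) < e/2"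
      using st by (intro d near) auto
    moreover have "dist (B (x + t' *\<^sub>R u + s' *\<^sub>R v)) (B x) < e/2"
      using st' by (intro d near) auto
    ultimately show ?thesis unfolding dist_real_def by linarith
  qed
  then have "\<bar>A x - B x\<bar> \<le> 0" by (meson less_irrefl not_le)
  then show ?thesis by (simp add: A_def B_def)
qed

lemma fderiv_commute:
  fixes f :: "'a::euclidean_space \<Rightarrow> 'b::euclidean_space"
  assumes "open U" "x \<in> U" and f: "smooth_on U f"
  shows "fderiv (\<lambda>y. fderiv f y u) x v = fderiv (\<lambda>y. fderiv f y v) x u"
proof (rule euclidean_eqI)
  fix b :: 'b
  have inner: "fderiv (\<lambda>y. F y \<bullet> b) y = (\<lambda>w. fderiv F y w \<bullet> b)" if "smooth_on U F" "y \<in> U" 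
    for y and F :: "'a \<Rightarrow> 'b"
    by (intro fderiv_eqI bounded_linear.has_derivative[OF bounded_linear_inner_left] smooth_on_has_fderiv[OF that])
  have fb: "smooth_on U (\<lambda>y. f y \<bullet> b)"
    by (rule smooth_on_linear[OF assms(1) bounded_linear_inner_left f])
  have "fderiv (\<lambda>y. fderiv f y u) x v \<bullet> b = fderiv (\<lambda>y. fderiv (\<lambda>y. f y \<bullet> b) y u) x v" for u v
  proof -
    have "fderiv (\<lambda>y. fderiv f y u) x v \<bullet> b = fderiv (\<lambda>y. fderiv f y u \<bullet> b) x v"
      by (simp add: inner[OF smooth_on_fderiv[OF f] assms(2)])
    also have "\<dots> = fderiv (\<lambda>y. fderiv (\<lambda>y. f y \<bullet> b) y u) x v"
      by (subst fderiv_cong_open(1)[OF assms(1,2), of "\<lambda>y. fderiv (\<lambda>y. f y \<bullet> b) y u"])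
        (auto simp: inner[OF f] intro!: smooth_on_differentiable[OF _ assms(2)] smooth_on_fderiv fb)
    finally show ?thesis .
  qed
  then show "fderiv (\<lambda>y. fderiv f y u) x v \<bullet> b = fderiv (\<lambda>y. fderiv f y v) x u \<bullet> b"
    using fderiv_commute_real[OF assms(1,2) fb] by simp
qed

subsection \<open>Rules for derivatives\<close>

lemma fderiv_add:
  assumes "smooth_on U f" "smooth_on U g" "x \<in> U"
  shows "fderiv (\<lambda>y. f y + g y) x h = fderiv f x h + fderiv g x h"
  using fderiv_eqI[OF has_derivative_add[OF smooth_on_has_fderiv[OF assms(1,3)]
        smooth_on_has_fderiv[OF assms(2,3)]]] by simp

lemma fderiv_diff:
  assumes "smooth_on U f" "smooth_on U g" "x \<in> U"
  shows "fderiv (\<lambda>y. f y - g y) x h = fderiv f x h - fderiv g x h"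
  using fderiv_eqI[OF has_derivative_diff[OF smooth_on_has_fderiv[OF assms(1,3)]
        smooth_on_has_fderiv[OF assms(2,3)]]] by simp

lemma fderiv_sum:
  assumes "\<And>i. i \<in> I \<Longrightarrow> smooth_on U (f i)" "x \<in> U"
  shows "fderiv (\<lambda>y. \<Sum>i\<in>I. f i y) x h = (\<Sum>i\<in>I. fderiv (f i) x h)"
proof -
  have "((\<lambda>y. \<Sum>i\<in>I. f i y) has_derivative (\<lambda>h. \<Sum>i\<in>I. fderiv (f i) x h)) (at x)"
    by (intro has_derivative_sum smooth_on_has_fderiv[OF assms])
  then show ?thesis by (simp add: fderiv_eqI)
qed

lemma fderiv_scaleR:
  assumes "smooth_on U f" "smooth_on U g" "x \<in> U"
  shows "fderiv (\<lambda>y. f y *\<^sub>R g y) x h = fderiv f x h *\<^sub>R g x + f x *\<^sub>R fderiv g x h"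
  using fderiv_eqI[OF has_derivative_scaleR[OF smooth_on_has_fderiv[OF assms(1,3)]
        smooth_on_has_fderiv[OF assms(2,3)]]] by simp

lemma fderiv_mult:
  fixes f g :: "'a::euclidean_space \<Rightarrow> real"
  assumes "smooth_on U f" "smooth_on U g" "x \<in> U"
  shows "fderiv (\<lambda>y. f y * g y) x h = fderiv f x h * g x + f x * fderiv g x h"
  using fderiv_scaleR[OF assms] by simp

lemma fderiv_bounded_linear:
  assumes "bounded_linear L" "smooth_on U f" "x \<in> U"
  shows "fderiv (\<lambda>y. L (f y)) x h = L (fderiv f x h)"
  by (simp add: fderiv_eqI[OF bounded_linear.has_derivative[OF assms(1)
        smooth_on_has_fderiv[OF assms(2,3)]]])

lemma fderiv_vec_nth:
  "smooth_on U f \<Longrightarrow> x \<in> U \<Longrightarrow> fderiv (\<lambda>y. f y $ i) x h = fderiv f x h $ i"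
  by (rule fderiv_bounded_linear[OF bounded_linear_vec_nth])

lemma fderiv_cong:
  assumes "open U" "smooth_on U f" "x \<in> U" "\<And>y. y \<in> U \<Longrightarrow> f y = g y"
  shows "fderiv f x = fderiv g x"
  using fderiv_cong_open(1)[OF assms(1,3,4) smooth_on_differentiable[OF assms(2,3)]] by simp

subsection \<open>Smooth families of linear and bilinear maps\<close>

text \<open>
  Smoothness is demanded for fixed arguments only. On a finite-dimensional space the expansion of the
  argument in a basis extends it to smoothly varying arguments, and gives the product rule.
\<close>

definition linear_family ::
  "'a::euclidean_space set \<Rightarrow> ('a \<Rightarrow> 'c::euclidean_space \<Rightarrow> 'b::real_normed_vector) \<Rightarrow> bool" where
  "linear_family U L \<longleftrightarrow> (\<forall>x\<in>U. linear (L x)) \<and> (\<forall>v. smooth_on U (\<lambda>x. L x v))"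

definition bilinear_family ::
  "'a::euclidean_space set \<Rightarrow>
    ('a \<Rightarrow> 'c::euclidean_space \<Rightarrow> 'd::euclidean_space \<Rightarrow> 'b::real_normed_vector) \<Rightarrow> bool" where
  "bilinear_family U B \<longleftrightarrow>
    (\<forall>u. linear_family U (\<lambda>x. B x u)) \<and> (\<forall>v. linear_family U (\<lambda>x u. B x u v))"

lemma linear_familyD:
  "linear_family U L \<Longrightarrow> x \<in> U \<Longrightarrow> linear (L x)"
  "linear_family U L \<Longrightarrow> smooth_on U (\<lambda>x. L x v)"
  by (auto simp: linear_family_def)

lemma linear_basis_sum:
  fixes L :: "'c::euclidean_space \<Rightarrow> 'b::real_vector"
  assumes "linear L"
  shows "L v = (\<Sum>b\<in>Basis. (v \<bullet> b) *\<^sub>R L b)"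
  using linear_sum[OF assms, of "\<lambda>b. (v \<bullet> b) *\<^sub>R b" Basis]
  by (simp add: euclidean_representation linear_scale[OF assms])

lemma linear_family_smooth:
  assumes "open U" "linear_family U L" "smooth_on U Z"
  shows "smooth_on U (\<lambda>x. L x (Z x))"
proof -
  have "smooth_on U (\<lambda>x. \<Sum>b\<in>Basis. (Z x \<bullet> b) *\<^sub>R L x b)"
    by (intro smooth_on_sum smooth_on_scaleR smooth_on_linear[OF _ bounded_linear_inner_left]
        assms linear_familyD(2))
  then show ?thesis
    by (rule smooth_on_cong[OF assms(1)]) (rule linear_basis_sum[symmetric, OF linear_familyD(1)[OF assms(2)]])
qed

lemma linear_family_fderiv:
  assumes "open U" "linear_family U L" "smooth_on U Z" "x \<in> U"
  shows "fderiv (\<lambda>y. L y (Z y)) x h = fderiv (\<lambda>y. L y (Z x)) x h + L x (fderiv Z x h)"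
proof -
  have sm: "smooth_on U (\<lambda>y. (Z y \<bullet> b) *\<^sub>R L y b)" "smooth_on U (\<lambda>y. (Z x \<bullet> b) *\<^sub>R L y b)"
    "smooth_on U (\<lambda>y. Z y \<bullet> b)" "smooth_on U (\<lambda>y. L y b)" for b
    by (intro smooth_on_scaleR smooth_on_linear[OF _ bounded_linear_inner_left] smooth_on_const
        assms linear_familyD(2)[OF assms(2)])+
  note rep = linear_basis_sum[OF linear_familyD(1)[OF assms(2)]]
  have "fderiv (\<lambda>y. L y (Z y)) x h = fderiv (\<lambda>y. \<Sum>b\<in>Basis. (Z y \<bullet> b) *\<^sub>R L y b) x h"
    by (subst fderiv_cong[OF assms(1) linear_family_smooth[OF assms(1-3)] assms(4) rep]) simp_all
  also have "\<dots> = (\<Sum>b\<in>Basis. (fderiv Z x h \<bullet> b) *\<^sub>R L x b + (Z x \<bullet> b) *\<^sub>R fderiv (\<lambda>y. L y b) x h)"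
    by (subst fderiv_sum[OF sm(1) assms(4)])
      (simp_all add: fderiv_scaleR[OF sm(3,4) assms(4)]
        fderiv_bounded_linear[OF bounded_linear_inner_left assms(3,4)])
  also have "\<dots> = (\<Sum>b\<in>Basis. (Z x \<bullet> b) *\<^sub>R fderiv (\<lambda>y. L y b) x h) + L x (fderiv Z x h)"
    by (simp add: sum.distrib rep[OF assms(4), of "fderiv Z x h", symmetric])
  also have "(\<Sum>b\<in>Basis. (Z x \<bullet> b) *\<^sub>R fderiv (\<lambda>y. L y b) x h)
      = fderiv (\<lambda>y. \<Sum>b\<in>Basis. (Z x \<bullet> b) *\<^sub>R L y b) x h"
    by (subst fderiv_sum[OF sm(2) assms(4)])
      (simp_all add: fderiv_scaleR[OF smooth_on_const[OF assms(1)] sm(4) assms(4)])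
  also have "\<dots> = fderiv (\<lambda>y. L y (Z x)) x h"
    by (subst fderiv_cong[OF assms(1) linear_familyD(2)[OF assms(2)] assms(4) rep]) simp_all
  finally show ?thesis .
qed

lemma linear_family_derivative:
  assumes "open U" "linear_family U L"
  shows "linear_family U (\<lambda>x v. fderiv (\<lambda>y. L y v) x h)"
  unfolding linear_family_def
proof (intro conjI ballI allI)
  fix x assume x: "x \<in> U"
  note L = linear_familyD[OF assms(2)]
  show "linear (\<lambda>v. fderiv (\<lambda>y. L y v) x h)"
  proof (rule linearI)
    fix u v
    show "fderiv (\<lambda>y. L y (u + v)) x h = fderiv (\<lambda>y. L y u) x h + fderiv (\<lambda>y. L y v) x h"
      by (subst fderiv_cong[OF assms(1) L(2) x, of _ "\<lambda>y. L y u + L y v"])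
        (simp_all add: linear_add[OF L(1)] fderiv_add[OF L(2) L(2) x])
  next
    fix r v
    show "fderiv (\<lambda>y. L y (r *\<^sub>R v)) x h = r *\<^sub>R fderiv (\<lambda>y. L y v) x h"
      by (subst fderiv_cong[OF assms(1) L(2) x, of _ "\<lambda>y. r *\<^sub>R L y v"])
        (simp_all add: linear_scale[OF L(1)] fderiv_scaleR[OF smooth_on_const[OF assms(1)] L(2) x])
  qed
next
  fix v
  show "smooth_on U (\<lambda>x. fderiv (\<lambda>y. L y v) x h)"
    by (intro smooth_on_fderiv linear_familyD(2)[OF assms(2)])
qed

lemma bilinear_familyD:
  "bilinear_family U B \<Longrightarrow> linear_family U (\<lambda>x. B x u)"
  "bilinear_family U B \<Longrightarrow> linear_family U (\<lambda>x u. B x u v)"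
  by (auto simp: bilinear_family_def)

lemma bilinear_family_smooth_const: "bilinear_family U B \<Longrightarrow> smooth_on U (\<lambda>x. B x u v)"
  by (rule linear_familyD(2)[OF bilinear_familyD(1)])

lemma bilinear_family_bilinear: "bilinear_family U B \<Longrightarrow> x \<in> U \<Longrightarrow> bilinear (B x)"
  by (simp add: bilinear_def linear_familyD(1)[OF bilinear_familyD(1)]
      linear_familyD(1)[OF bilinear_familyD(2)])

lemma bilinear_family_smooth:
  assumes "open U" "bilinear_family U B" "smooth_on U Y" "smooth_on U Z"
  shows "smooth_on U (\<lambda>x. B x (Y x) (Z x))"
proof -
  have "linear_family U (\<lambda>x. B x (Y x))"
    using linear_family_smooth[OF assms(1) bilinear_familyD(2)[OF assms(2)] assms(3)]
    by (auto simp: linear_family_def linear_familyD(1)[OF bilinear_familyD(1)[OF assms(2)]])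
  then show ?thesis by (rule linear_family_smooth[OF assms(1) _ assms(4)])
qed

lemma bilinear_family_fderiv:
  assumes "open U" "bilinear_family U B" "smooth_on U Y" "smooth_on U Z" "x \<in> U"
  shows "fderiv (\<lambda>y. B y (Y y) (Z y)) x h =
    fderiv (\<lambda>y. B y (Y x) (Z x)) x h + B x (fderiv Y x h) (Z x) + B x (Y x) (fderiv Z x h)"
proof -
  have "linear_family U (\<lambda>x. B x (Y x))"
    using linear_family_smooth[OF assms(1) bilinear_familyD(2)[OF assms(2)] assms(3)]
    by (auto simp: linear_family_def linear_familyD(1)[OF bilinear_familyD(1)[OF assms(2)]])
  from linear_family_fderiv[OF assms(1) this assms(4,5)]
  have "fderiv (\<lambda>y. B y (Y y) (Z y)) x h = fderiv (\<lambda>y. B y (Y y) (Z x)) x h + B x (Y x) (fderiv Z x h)" .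
  also have "fderiv (\<lambda>y. B y (Y y) (Z x)) x h = fderiv (\<lambda>y. B y (Y x) (Z x)) x h + B x (fderiv Y x h) (Z x)"
    by (rule linear_family_fderiv[OF assms(1) bilinear_familyD(2)[OF assms(2)] assms(3,5)])
  finally show ?thesis by simp
qed

lemma bilinear_family_derivative:
  assumes "open U" "bilinear_family U B"
  shows "bilinear_family U (\<lambda>x u v. fderiv (\<lambda>y. B y u v) x h)"
  unfolding bilinear_family_def
  using linear_family_derivative[OF assms(1) bilinear_familyD(1)[OF assms(2)]]
    linear_family_derivative[OF assms(1) bilinear_familyD(2)[OF assms(2)]] by blast

lemma linear_family_fderiv_family:
  "smooth_on U f \<Longrightarrow> linear_family U (\<lambda>x v. fderiv f x v)"
  by (simp add: linear_family_def smooth_on_linear_fderiv smooth_on_fderiv)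

lemma matrix_inv_inverse:
  assumes "invertible A"
  shows "A ** matrix_inv A = mat 1" "matrix_inv A ** A = mat 1"
  using someI_ex[OF assms[unfolded invertible_def]] by (auto simp: matrix_inv_def)

section \<open>Metrics on open subsets of a Euclidean space\<close>

lemma linear_axis_sum:
  fixes L :: "real ^ 'n \<Rightarrow> 'b::real_vector"
  assumes "linear L"
  shows "L v = (\<Sum>i\<in>UNIV. v $ i *\<^sub>R L (axis i 1))"
  using linear_sum[OF assms, of "\<lambda>i. v $ i *\<^sub>R axis i 1" UNIV]
  by (simp add: vec_axis_sum[symmetric] linear_scale[OF assms])

locale local_metric =
  fixes U :: "(real ^ 'n::finite) set"
    and G :: "real ^ 'n \<Rightarrow> real ^ 'n \<Rightarrow> real ^ 'n \<Rightarrow> real"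
  assumes open_U: "open U"
    and G_family: "bilinear_family U G"
    and G_sym: "x \<in> U \<Longrightarrow> G x u v = G x v u"
    and G_pos: "x \<in> U \<Longrightarrow> v \<noteq> 0 \<Longrightarrow> 0 < G x v v"
begin

definition gram :: "real ^ 'n \<Rightarrow> real ^ 'n ^ 'n" where
  "gram x = (\<chi> i j. G x (axis i 1) (axis j 1))"

text \<open>The vector dual to a covector \<open>w\<close> with respect to the metric at \<open>x\<close>.\<close>

definition sharp :: "real ^ 'n \<Rightarrow> (real ^ 'n \<Rightarrow> real) \<Rightarrow> real ^ 'n" where
  "sharp x w = matrix_inv (gram x) *v (\<chi> k. w (axis k 1))"

lemma G_smooth: "smooth_on U (\<lambda>x. G x u v)"
  by (rule bilinear_family_smooth_const[OF G_family])

lemmas G_bilinear = bilinear_family_bilinear[OF G_family]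

lemmas G_simps =
  bilinear_ladd[OF G_bilinear] bilinear_radd[OF G_bilinear]
  bilinear_lsub[OF G_bilinear] bilinear_rsub[OF G_bilinear]
  bilinear_lmul[OF G_bilinear] bilinear_rmul[OF G_bilinear]
  bilinear_lneg[OF G_bilinear] bilinear_rneg[OF G_bilinear]

lemma gram_mult: "x \<in> U \<Longrightarrow> (gram x *v v) $ i = G x (axis i 1) v"
  unfolding matrix_vector_mult_def gram_def
  by (subst linear_axis_sum[of "G x (axis i 1)"])
    (auto simp: linear_familyD(1)[OF bilinear_familyD(1)[OF G_family]] mult.commute)

lemma inner_gram: "x \<in> U \<Longrightarrow> u \<bullet> (gram x *v v) = G x u v"
  unfolding inner_vec_def
  by (subst linear_axis_sum[of "\<lambda>u. G x u v"])
    (auto simp: linear_familyD(1)[OF bilinear_familyD(2)[OF G_family]] gram_mult)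

lemma invertible_gram: "x \<in> U \<Longrightarrow> invertible (gram x)"
proof -
  assume x: "x \<in> U"
  have "u = 0" if "gram x *v u = 0" for u
    using inner_gram[OF x, of u u] G_pos[OF x, of u] that by fastforce
  then show ?thesis
    unfolding invertible_left_inverse matrix_left_invertible_ker by blast
qed

lemma G_eqI:
  assumes "x \<in> U" "\<And>w. G x u w = G x v w"
  shows "u = v"
  using assms G_pos[OF assms(1), of "u - v"] by (force simp: G_simps)

lemma gram_sharp: "x \<in> U \<Longrightarrow> gram x *v sharp x w = (\<chi> k. w (axis k 1))"
  by (simp add: sharp_def matrix_vector_mul_assoc matrix_inv_inverse(1)[OF invertible_gram])

lemma G_sharp:
  assumes "x \<in> U" "linear w"
  shows "G x (sharp x w) v = w v"
proof -
  have "G x (sharp x w) v = v \<bullet> (gram x *v sharp x w)"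
    by (simp add: inner_gram[OF assms(1)] G_sym[OF assms(1)])
  also have "\<dots> = w v"
    by (subst linear_axis_sum[OF assms(2), of v]) (simp add: gram_sharp[OF assms(1)] inner_vec_def)
  finally show ?thesis .
qed

lemma gram_smooth: "smooth_on U (\<lambda>x. gram x $ i $ j)"
  by (simp add: gram_def G_smooth)

lemma det_gram: "x \<in> U \<Longrightarrow> det (gram x) \<noteq> 0"
  using invertible_gram invertible_det_nz by blast

lemma sharp_smooth:
  assumes "\<And>v. smooth_on U (\<lambda>x. w x v)"
  shows "smooth_on U (\<lambda>x. sharp x (w x))"
  by (rule smooth_on_solve[OF open_U gram_smooth, of "\<lambda>x. \<chi> k. w x (axis k 1)"])
    (simp_all add: assms det_gram gram_sharp)

lemma matrix_inv_gram_smooth: "smooth_on U (\<lambda>x. matrix_inv (gram x) $ i $ j)"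
proof -
  have "smooth_on U (\<lambda>x. matrix_inv (gram x) *v axis j 1)"
    by (rule smooth_on_solve[OF open_U gram_smooth, of "\<lambda>x. axis j 1"])
      (simp_all add: smooth_on_const open_U det_gram matrix_vector_mul_assoc
        matrix_inv_inverse(1)[OF invertible_gram])
  from smooth_on_vec_nth[OF open_U this] show ?thesis
    by (simp add: matrix_vector_mult_basis column_def)
qed

subsection \<open>The Christoffel symbols\<close>

text \<open>
  The Koszul formula for constant vector fields, whose Lie brackets vanish.
\<close>

definition koszul :: "real ^ 'n \<Rightarrow> real ^ 'n \<Rightarrow> real ^ 'n \<Rightarrow> real ^ 'n \<Rightarrow> real" where
  "koszul x u v w = 1/2 * (fderiv (\<lambda>y. G y v w) x u + fderiv (\<lambda>y. G y u w) x v
     - fderiv (\<lambda>y. G y u v) x w)"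

definition Gam :: "real ^ 'n \<Rightarrow> real ^ 'n \<Rightarrow> real ^ 'n \<Rightarrow> real ^ 'n" where
  "Gam x u v = sharp x (koszul x u v)"

lemma dG_linear:
  assumes "x \<in> U"
  shows "linear (\<lambda>h. fderiv (\<lambda>y. G y u v) x h)"
    "linear (\<lambda>u. fderiv (\<lambda>y. G y u v) x h)"
    "linear (\<lambda>v. fderiv (\<lambda>y. G y u v) x h)"
  using smooth_on_linear_fderiv[OF G_smooth assms]
    bilinear_family_bilinear[OF bilinear_family_derivative[OF open_U G_family] assms]
  by (auto simp: bilinear_def)

lemmas dG_simps = linear_add[OF dG_linear(1)] linear_add[OF dG_linear(2)] linear_add[OF dG_linear(3)]
  linear_scale[OF dG_linear(1)] linear_scale[OF dG_linear(2)] linear_scale[OF dG_linear(3)]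

lemma dG_sym: "x \<in> U \<Longrightarrow> fderiv (\<lambda>y. G y u v) x = fderiv (\<lambda>y. G y v u) x"
  by (rule fderiv_cong[OF open_U G_smooth]) (auto intro: G_sym)

lemma koszul_linear: "x \<in> U \<Longrightarrow> linear (koszul x u v)"
  by (rule linearI) (simp_all add: koszul_def dG_simps algebra_simps)

lemma G_Gam: "x \<in> U \<Longrightarrow> G x (Gam x u v) w = koszul x u v w"
  unfolding Gam_def by (rule G_sharp[OF _ koszul_linear])

lemma Gam_sym:
  assumes x: "x \<in> U"
  shows "Gam x u v = Gam x v u"
proof (rule G_eqI[OF x])
  fix w
  show "G x (Gam x u v) w = G x (Gam x v u) w"
    unfolding G_Gam[OF x] koszul_def dG_sym[OF x, of v u] by simp
qed

lemma Gam_family: "bilinear_family U Gam"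
proof -
  have lin: "linear (Gam x u)" if "x \<in> U" for x u
    by (rule linearI; rule G_eqI[OF that])
      (simp_all add: that G_simps G_Gam koszul_def dG_simps algebra_simps)
  have "linear (\<lambda>u. Gam x u v)" if "x \<in> U" for x v
    using lin[OF that, of v] by (simp add: Gam_sym[OF that, of _ v])
  moreover have "smooth_on U (\<lambda>x. Gam x u v)" for u v
    unfolding Gam_def koszul_def
    by (intro sharp_smooth smooth_on_mult smooth_on_diff smooth_on_add smooth_on_const
        smooth_on_fderiv G_smooth open_U)
  ultimately show ?thesis
    using lin by (simp add: bilinear_family_def linear_family_def)
qed

lemma Gam_metric:
  "x \<in> U \<Longrightarrow> fderiv (\<lambda>y. G y u v) x h = G x (Gam x h u) v + G x u (Gam x h v)"
  by (simp add: G_Gam G_sym[of x u] koszul_def dG_sym[of x u v] dG_sym[of x v h] dG_sym[of x h u]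
      field_simps)

lemma Gam_smooth: "smooth_on U (\<lambda>x. Gam x u v)"
  by (rule bilinear_family_smooth_const[OF Gam_family])

lemmas Gam_bilinear = bilinear_family_bilinear[OF Gam_family]

lemmas Gam_simps =
  bilinear_ladd[OF Gam_bilinear] bilinear_radd[OF Gam_bilinear]
  bilinear_lsub[OF Gam_bilinear] bilinear_rsub[OF Gam_bilinear]
  bilinear_lmul[OF Gam_bilinear] bilinear_rmul[OF Gam_bilinear]
  bilinear_lneg[OF Gam_bilinear] bilinear_rneg[OF Gam_bilinear]

abbreviation dGam :: "real ^ 'n \<Rightarrow> real ^ 'n \<Rightarrow> real ^ 'n \<Rightarrow> real ^ 'n \<Rightarrow> real ^ 'n" where
  "dGam x h u v \<equiv> fderiv (\<lambda>y. Gam y u v) x h"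

lemma dGam_linear:
  assumes "x \<in> U"
  shows "linear (\<lambda>h. dGam x h u v)" "linear (\<lambda>u. dGam x h u v)" "linear (\<lambda>v. dGam x h u v)"
  using smooth_on_linear_fderiv[OF Gam_smooth assms]
    bilinear_family_bilinear[OF bilinear_family_derivative[OF open_U Gam_family] assms]
  by (auto simp: bilinear_def)

lemma dGam_sym: "x \<in> U \<Longrightarrow> dGam x h u v = dGam x h v u"
  by (subst fderiv_cong[OF open_U Gam_smooth]) (auto intro: Gam_sym)

lemma dGam_smooth: "smooth_on U (\<lambda>x. dGam x h u v)"
  by (intro smooth_on_fderiv Gam_smooth)

subsection \<open>Curvature\<close>

text \<open>
  The curvature \<open>\<nabla>\<^sub>u\<nabla>\<^sub>v w - \<nabla>\<^sub>v\<nabla>\<^sub>u w\<close> of constant vector fields.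
\<close>

definition Curv :: "real ^ 'n \<Rightarrow> real ^ 'n \<Rightarrow> real ^ 'n \<Rightarrow> real ^ 'n \<Rightarrow> real ^ 'n" where
  "Curv x u v w = dGam x u v w - dGam x v u w + Gam x u (Gam x v w) - Gam x v (Gam x u w)"

lemma Gam_Gam_smooth: "smooth_on U (\<lambda>x. Gam x u (Gam x v w))"
  by (rule linear_family_smooth[OF open_U bilinear_familyD(1)[OF Gam_family] Gam_smooth])

lemma Curv_smooth: "smooth_on U (\<lambda>x. Curv x u v w)"
  unfolding Curv_def
  by (intro smooth_on_diff smooth_on_add dGam_smooth Gam_Gam_smooth open_U)

lemma Curv_antisym: "Curv x u v w = - Curv x v u w"
  by (simp add: Curv_def)

lemma Curv_linear:
  assumes x: "x \<in> U"
  shows "linear (\<lambda>u. Curv x u v w)" "linear (\<lambda>v. Curv x u v w)" "linear (\<lambda>w. Curv x u v w)"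
proof -
  note lins = linear_add[OF dGam_linear(1)[OF x]] linear_add[OF dGam_linear(2)[OF x]]
    linear_add[OF dGam_linear(3)[OF x]] linear_scale[OF dGam_linear(1)[OF x]]
    linear_scale[OF dGam_linear(2)[OF x]] linear_scale[OF dGam_linear(3)[OF x]]
  show "linear (\<lambda>u. Curv x u v w)" "linear (\<lambda>v. Curv x u v w)" "linear (\<lambda>w. Curv x u v w)"
    by (rule linearI; simp add: Curv_def lins Gam_simps x algebra_simps)+
qed

lemmas Curv_simps =
  linear_add[OF Curv_linear(1)] linear_add[OF Curv_linear(2)] linear_add[OF Curv_linear(3)]
  linear_diff[OF Curv_linear(1)] linear_diff[OF Curv_linear(2)] linear_diff[OF Curv_linear(3)]
  linear_scale[OF Curv_linear(1)] linear_scale[OF Curv_linear(2)] linear_scale[OF Curv_linear(3)]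

lemma first_Bianchi:
  assumes x: "x \<in> U"
  shows "Curv x u v w + Curv x v w u + Curv x w u v = 0"
proof -
  have "Gam x w u = Gam x u w" "Gam x w v = Gam x v w" "Gam x v u = Gam x u v"
    "dGam x v w u = dGam x v u w" "dGam x u w v = dGam x u v w" "dGam x w v u = dGam x w u v"
    by (rule Gam_sym[OF x] dGam_sym[OF x])+
  then show ?thesis unfolding Curv_def by (simp only:) (simp add: algebra_simps)
qed

text \<open>Second derivatives of the function \<open>G w z\<close> commute, and each of them is expressed by
  \<open>\<nabla>G = 0\<close>.\<close>

lemma Curv_skew:
  assumes x: "x \<in> U"
  shows "G x (Curv x u v w) z = - G x w (Curv x u v z)"
proof -
  have dd: "fderiv (\<lambda>y. fderiv (\<lambda>y. G y w z) y v) x u =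
      G x (Gam x u (Gam x v w)) z + G x (Gam x v w) (Gam x u z) + G x (dGam x u v w) z
      + G x (Gam x u w) (Gam x v z) + G x w (Gam x u (Gam x v z)) + G x w (dGam x u v z)" for u v
  proof -
    have s: "smooth_on U (\<lambda>y. G y (Gam y v w) z)" "smooth_on U (\<lambda>y. G y w (Gam y v z))"
      by (intro bilinear_family_smooth[OF open_U G_family] Gam_smooth smooth_on_const open_U)+
    have "fderiv (\<lambda>y. fderiv (\<lambda>y. G y w z) y v) x u =
        fderiv (\<lambda>y. G y (Gam y v w) z + G y w (Gam y v z)) x u"
      by (subst fderiv_cong[OF open_U smooth_on_fderiv[OF G_smooth] x Gam_metric]) simp_all
    also have "\<dots> = fderiv (\<lambda>y. G y (Gam y v w) z) x u + fderiv (\<lambda>y. G y w (Gam y v z)) x u"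
      by (rule fderiv_add[OF s x])
    also have "fderiv (\<lambda>y. G y (Gam y v w) z) x u =
        fderiv (\<lambda>y. G y (Gam x v w) z) x u + G x (dGam x u v w) z"
      by (rule linear_family_fderiv[OF open_U bilinear_familyD(2)[OF G_family] Gam_smooth x])
    also have "fderiv (\<lambda>y. G y w (Gam y v z)) x u =
        fderiv (\<lambda>y. G y w (Gam x v z)) x u + G x w (dGam x u v z)"
      by (rule linear_family_fderiv[OF open_U bilinear_familyD(1)[OF G_family] Gam_smooth x])
    finally show ?thesis by (simp add: Gam_metric x)
  qed
  show ?thesis
    using fderiv_commute[OF open_U x G_smooth, of w z v u] unfolding dd Curv_def
    by (simp add: G_simps x)
qed

text \<open>
  The classical argument: a signed sum of the four instances of the first Bianchi identity for the
  cyclic rotations of the arguments.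
\<close>

lemma Curv_pair_sym:
  assumes x: "x \<in> U"
  shows "G x (Curv x u v w) z = G x (Curv x w z u) v"
proof -
  define K where "K u v w z = G x (Curv x u v w) z" for u v w z
  have 1: "K u v w z = - K v u w z" for u v w z
    unfolding K_def by (subst Curv_antisym) (simp add: G_simps x)
  have 2: "K u v w z = - K u v z w" for u v w z
    unfolding K_def by (simp add: Curv_skew[OF x, of u v w z] G_sym[OF x, of w])
  have 3: "K u v w z + K v w u z + K w u v z = 0" for u v w z
    using first_Bianchi[OF x, of u v w] unfolding K_def
    by (simp add: G_simps[OF x, symmetric]) (simp add: bilinear_lzero[OF G_bilinear] x)
  have "K u v w z = K w z u v"
    using 3[of u v w z] 3[of v w z u] 3[of w z u v] 3[of z u v w]
      1[of w u v z] 2[of v w z u] 2[of w z v u] 1[of z v w u] 2[of v z w u] 1[of z u w v]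
      2[of u z w v] 2[of u w z v] 1[of z u v w] 2[of u v z w]
    by linarith
  then show ?thesis by (simp add: K_def)
qed

abbreviation dCurv :: "real ^ 'n \<Rightarrow> real ^ 'n \<Rightarrow> real ^ 'n \<Rightarrow> real ^ 'n \<Rightarrow> real ^ 'n \<Rightarrow> real ^ 'n" where
  "dCurv x h u v w \<equiv> fderiv (\<lambda>y. Curv y u v w) x h"

lemma dCurv_eq:
  assumes x: "x \<in> U"
  shows "dCurv x h u v w =
    fderiv (\<lambda>y. dGam y u v w) x h - fderiv (\<lambda>y. dGam y v u w) x h
    + (dGam x h u (Gam x v w) + Gam x u (dGam x h v w))
    - (dGam x h v (Gam x u w) + Gam x v (dGam x h u w))"
proof -
  have GG: "fderiv (\<lambda>y. Gam y u (Gam y v w)) x h = dGam x h u (Gam x v w) + Gam x u (dGam x h v w)"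
    for u v
    by (rule linear_family_fderiv[OF open_U bilinear_familyD(1)[OF Gam_family] Gam_smooth x])
  note s = smooth_on_diff[OF open_U dGam_smooth dGam_smooth] 
  show ?thesis
    unfolding Curv_def
    by (simp add: fderiv_diff[OF smooth_on_add[OF open_U s Gam_Gam_smooth] Gam_Gam_smooth x]
        fderiv_add[OF s Gam_Gam_smooth x] fderiv_diff[OF dGam_smooth dGam_smooth x] GG)
qed

text \<open>
  For coordinate vector fields, which commute, this is the Jacobi identity for the operators
  \<open>\<nabla>\<^sub>u\<close>. The terms that \<open>\<nabla>\<close> contributes through the first two arguments of the
  curvature are left out: since the Christoffel symbols are symmetric, they cancel in the cyclic sum.
\<close>

lemma second_Bianchi:
  assumes x: "x \<in> U"
  shows "(dCurv x h u v w + Gam x h (Curv x u v w) - Curv x u v (Gam x h w))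
    + (dCurv x u v h w + Gam x u (Curv x v h w) - Curv x v h (Gam x u w))
    + (dCurv x v h u w + Gam x v (Curv x h u w) - Curv x h u (Gam x v w)) = 0"
proof -
  have c: "fderiv (\<lambda>y. dGam y u v w) x h = fderiv (\<lambda>y. dGam y h v w) x u" for u v h
    by (rule fderiv_commute[OF open_U x Gam_smooth])
  have g: "Gam x h (Curv x u v w) = Gam x h (dGam x u v w) - Gam x h (dGam x v u w)
      + Gam x h (Gam x u (Gam x v w)) - Gam x h (Gam x v (Gam x u w))" for u v h
    by (simp add: Curv_def Gam_simps x)
  show ?thesis
    unfolding dCurv_eq[OF x] g c[of u v h] c[of v u h] c[of h v u] unfolding Curv_def
    by simp
qed

subsection \<open>Ricci and scalar curvature\<close>

definition Ricci :: "real ^ 'n \<Rightarrow> real ^ 'n \<Rightarrow> real ^ 'n \<Rightarrow> real" where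
  "Ricci x v w = (\<Sum>i\<in>UNIV. Curv x (axis i 1) v w $ i)"

definition Scal :: "real ^ 'n \<Rightarrow> real" where
  "Scal x = (\<Sum>j\<in>UNIV. \<Sum>k\<in>UNIV. matrix_inv (gram x) $ j $ k * Ricci x (axis j 1) (axis k 1))"

lemma Ricci_smooth: "smooth_on U (\<lambda>x. Ricci x v w)"
  unfolding Ricci_def by (intro smooth_on_sum smooth_on_vec_nth Curv_smooth open_U)

lemma Scal_smooth: "smooth_on U Scal"
  unfolding Scal_def[abs_def]
  by (intro smooth_on_sum smooth_on_mult matrix_inv_gram_smooth Ricci_smooth open_U)

lemma Ricci_linear:
  assumes "x \<in> U"
  shows "linear (\<lambda>v. Ricci x v w)" "linear (\<lambda>w. Ricci x v w)"
  unfolding Ricci_def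
  by (rule linearI; simp add: Curv_simps assms sum.distrib sum_distrib_left)+

end

lemma trace_compose_commute:
  fixes S T :: "real ^ 'n \<Rightarrow> real ^ 'n"
  assumes "linear S" "linear T"
  shows "(\<Sum>i\<in>UNIV. S (T (axis i 1)) $ i) = (\<Sum>i\<in>UNIV. T (S (axis i 1)) $ i)"
proof -
  have "(\<Sum>i\<in>UNIV. S (T (axis i 1)) $ i) = (\<Sum>i\<in>UNIV. \<Sum>j\<in>UNIV. T (axis i 1) $ j * S (axis j 1) $ i)"
    by (subst linear_axis_sum[OF assms(1), of "T _"]) simp
  also have "\<dots> = (\<Sum>j\<in>UNIV. \<Sum>i\<in>UNIV. S (axis j 1) $ i * T (axis i 1) $ j)"
    by (subst sum.swap) (simp add: mult.commute)
  also have "\<dots> = (\<Sum>i\<in>UNIV. T (S (axis i 1)) $ i)"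
    by (subst linear_axis_sum[OF assms(2), of "S _"]) simp
  finally show ?thesis .
qed

section \<open>Gradient solitons in coordinates\<close>

text \<open>
  The function \<open>f\<close> stands for \<open>R - \<lambda>\<close>. The last condition is \<open>L\<^sub>\<xi> g = 2 f g\<close> on constant vector fields
  \<open>u\<close>, for which \<open>[\<xi>,u]\<close> is the negative derivative of \<open>\<xi>\<close> in the direction \<open>u\<close>.
\<close>

locale local_soliton = local_metric U G for U :: "(real ^ 'n::finite) set" and G +
  fixes xi :: "real ^ 'n \<Rightarrow> real ^ 'n" and f :: "real ^ 'n \<Rightarrow> real" and c :: real
  assumes xi_smooth: "smooth_on U xi"
    and f_smooth: "smooth_on U f"
    and c_nonzero: "c \<noteq> 0"
    and f_gradient: "x \<in> U \<Longrightarrow> fderiv f x u = c * G x (xi x) u"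
    and lie_metric: "x \<in> U \<Longrightarrow> fderiv (\<lambda>y. G y u v) x (xi x) + G x (fderiv xi x u) v
       + G x u (fderiv xi x v) = 2 * f x * G x u v"
begin

text \<open>
  The soliton equation prescribes the symmetric part of \<open>\<nabla>\<xi>\<close>. The skew part vanishes because
  the dual form of \<open>\<xi>\<close> is, up to the factor \<open>c\<close>, the differential of \<open>f\<close>.
\<close>

lemma fderiv_xi:
  assumes x: "x \<in> U"
  shows "fderiv xi x u = f x *\<^sub>R u - Gam x u (xi x)"
proof -
  define N where "N u = fderiv xi x u + Gam x u (xi x)" for u
  have sym: "G x (N u) v + G x u (N v) = 2 * f x * G x u v" for u v
    using lie_metric[OF x, of u v]
    by (simp add: N_def G_simps x Gam_metric Gam_sym[OF x, of "xi x"])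
  have dd: "c * G x (N u) v + c * G x (xi x) (Gam x u v) = fderiv (\<lambda>y. fderiv f y v) x u" for u v
  proof -
    have s: "smooth_on U (\<lambda>y. G y (xi y) v)"
      by (intro bilinear_family_smooth[OF open_U G_family] xi_smooth smooth_on_const open_U)
    have "fderiv (\<lambda>y. fderiv f y v) x u = fderiv (\<lambda>y. c * G y (xi y) v) x u"
      by (subst fderiv_cong[OF open_U smooth_on_fderiv[OF f_smooth] x f_gradient]) simp_all
    also have "\<dots> = c * fderiv (\<lambda>y. G y (xi y) v) x u"
      by (subst fderiv_mult[OF smooth_on_const[OF open_U] s x]) simp
    also have "fderiv (\<lambda>y. G y (xi y) v) x u = fderiv (\<lambda>y. G y (xi x) v) x u + G x (fderiv xi x u) v"
      by (rule linear_family_fderiv[OF open_U bilinear_familyD(2)[OF G_family] xi_smooth x])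
    finally show ?thesis by (simp add: Gam_metric x N_def G_simps algebra_simps)
  qed
  have "c * G x (N u) v = c * G x (N v) u" for u v
    using dd[of u v] dd[of v u] fderiv_commute[OF open_U x f_smooth, of v u]
    unfolding Gam_sym[OF x, of v u] by linarith
  then have skew: "G x (N u) v = G x u (N v)" for u v
    using c_nonzero by (simp add: G_sym[OF x, of u])
  have "N u = f x *\<^sub>R u"
    by (rule G_eqI[OF x]) (use sym[of u] skew[of u] in \<open>simp add: G_simps x\<close>)
  then show ?thesis unfolding N_def by (simp only: eq_diff_eq)
qed

text \<open>
  The Ricci identity for \<open>\<nabla>\<xi> = f id\<close>: the second derivatives of \<open>\<xi>\<close> commute.
\<close>

lemma Curv_xi:
  assumes x: "x \<in> U"
  shows "Curv x u v (xi x) = (c * G x (xi x) u) *\<^sub>R v - (c * G x (xi x) v) *\<^sub>R u"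
proof -
  have "fderiv (\<lambda>y. fderiv xi y u) x v = (c * G x (xi x) v) *\<^sub>R u - dGam x v u (xi x)
      - Gam x u (f x *\<^sub>R v - Gam x v (xi x))" for u v
  proof -
    have s: "smooth_on U (\<lambda>y. f y *\<^sub>R u)" "smooth_on U (\<lambda>y. Gam y u (xi y))"
      by (intro smooth_on_scaleR f_smooth smooth_on_const open_U
          linear_family_smooth[OF open_U bilinear_familyD(1)[OF Gam_family] xi_smooth])+
    have "fderiv (\<lambda>y. fderiv xi y u) x v = fderiv (\<lambda>y. f y *\<^sub>R u - Gam y u (xi y)) x v"
      by (subst fderiv_cong[OF open_U smooth_on_fderiv[OF xi_smooth] x fderiv_xi]) simp_all
    also have "\<dots> = fderiv (\<lambda>y. f y *\<^sub>R u) x v - fderiv (\<lambda>y. Gam y u (xi y)) x v"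
      by (rule fderiv_diff[OF s x])
    also have "fderiv (\<lambda>y. f y *\<^sub>R u) x v = (c * G x (xi x) v) *\<^sub>R u"
      by (subst fderiv_scaleR[OF f_smooth smooth_on_const[OF open_U] x]) (simp add: f_gradient x)
    also have "fderiv (\<lambda>y. Gam y u (xi y)) x v = dGam x v u (xi x) + Gam x u (fderiv xi x v)"
      by (rule linear_family_fderiv[OF open_U bilinear_familyD(1)[OF Gam_family] xi_smooth x])
    finally show ?thesis by (simp add: fderiv_xi[OF x])
  qed
  then have "(c * G x (xi x) v) *\<^sub>R u - dGam x v u (xi x) - Gam x u (f x *\<^sub>R v - Gam x v (xi x))
    = (c * G x (xi x) u) *\<^sub>R v - dGam x u v (xi x) - Gam x v (f x *\<^sub>R u - Gam x u (xi x))"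
    using fderiv_commute[OF open_U x xi_smooth, of u v] by simp
  then show ?thesis
    using Gam_sym[OF x, of u v] by (simp add: Curv_def Gam_simps x algebra_simps)
qed

text \<open>
  The pair symmetry moves \<open>\<xi>\<close> out of the second argument, and skewness then moves it into the third.
\<close>

lemma Curv_xi_middle:
  assumes x: "x \<in> U"
  shows "Curv x v (xi x) w = (c * G x v w) *\<^sub>R xi x - (c * G x (xi x) w) *\<^sub>R v"
proof (rule G_eqI[OF x])
  fix z
  have "G x (Curv x v (xi x) w) z = G x (Curv x w z v) (xi x)"
    by (rule Curv_pair_sym[OF x])
  also have "\<dots> = - G x v (Curv x w z (xi x))"
    by (rule Curv_skew[OF x])
  also have "\<dots> = G x ((c * G x v w) *\<^sub>R xi x - (c * G x (xi x) w) *\<^sub>R v) z"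
    by (simp add: Curv_xi x G_simps G_sym[OF x, of z] algebra_simps)
  finally show "G x (Curv x v (xi x) w) z = G x ((c * G x v w) *\<^sub>R xi x - (c * G x (xi x) w) *\<^sub>R v) z" .
qed

text \<open>
  The derivative of the curvature along \<open>\<xi>\<close>: the second Bianchi identity moves the derivative
  into a direction in which the curvature, having \<open>\<xi>\<close> as an argument, is explicitly known.
\<close>

lemma dCurv_xi:
  assumes x: "x \<in> U"
  shows "dCurv x (xi x) u v w =
    - Gam x (xi x) (Curv x u v w) + Curv x u v (Gam x (xi x) w)
    + Curv x (Gam x (xi x) u) v w + Curv x u (Gam x (xi x) v) w
    + (2 * c * f x) *\<^sub>R (G x u w *\<^sub>R v - G x v w *\<^sub>R u) - (2 * f x) *\<^sub>R Curv x u v w"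
proof -
  have double: "2 * a = 2 *\<^sub>R a" "a * 2 = 2 *\<^sub>R a" for a :: "real ^ 'n"
    by (simp_all add: vec_eq_iff)
  define P where "P u v = dCurv x u v (xi x) w + Gam x u (Curv x v (xi x) w)
      - Curv x v (xi x) (Gam x u w)" for u v
  have P: "P u v = - f x *\<^sub>R Curv x v u w + Curv x v (Gam x u (xi x)) w
      - (c * f x * G x u w) *\<^sub>R v + (c * f x * G x v w) *\<^sub>R u
      + (c * G x (Gam x u v) w) *\<^sub>R xi x - (c * G x (xi x) w) *\<^sub>R Gam x u v" for u v
  proof -
    have lf: "linear_family U (\<lambda>y z. Curv y v z w)"
      by (simp add: linear_family_def Curv_linear Curv_smooth)
    have s: "smooth_on U (\<lambda>y. c * G y v w)" "smooth_on U (\<lambda>y. c * G y (xi y) w)"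
      "smooth_on U (\<lambda>y. G y (xi y) w)"
      by (intro smooth_on_mult smooth_on_const G_smooth open_U
          linear_family_smooth[OF open_U bilinear_familyD(2)[OF G_family] xi_smooth])+
    have s': "smooth_on U (\<lambda>y. (c * G y v w) *\<^sub>R xi y)" "smooth_on U (\<lambda>y. (c * G y (xi y) w) *\<^sub>R v)"
      by (intro smooth_on_scaleR s xi_smooth smooth_on_const open_U)+
    have g: "fderiv (\<lambda>y. G y (xi y) w) x u = G x (xi x) (Gam x u w) + f x * G x u w"
      using linear_family_fderiv[OF open_U bilinear_familyD(2)[OF G_family] xi_smooth x, of w u]
      by (simp add: Gam_metric x fderiv_xi G_simps)
    have "dCurv x u v (xi x) w + Curv x v (fderiv xi x u) w = fderiv (\<lambda>y. Curv y v (xi y) w) x u"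
      by (rule linear_family_fderiv[OF open_U lf xi_smooth x, symmetric])
    also have "\<dots> = fderiv (\<lambda>y. (c * G y v w) *\<^sub>R xi y - (c * G y (xi y) w) *\<^sub>R v) x u"
      by (subst fderiv_cong[OF open_U linear_family_smooth[OF open_U lf xi_smooth] x Curv_xi_middle]) simp_all
    also have "\<dots> = fderiv (\<lambda>y. (c * G y v w) *\<^sub>R xi y) x u - fderiv (\<lambda>y. (c * G y (xi y) w) *\<^sub>R v) x u"
      by (rule fderiv_diff[OF s' x])
    also have "fderiv (\<lambda>y. (c * G y v w) *\<^sub>R xi y) x u =
        (c * (G x (Gam x u v) w + G x v (Gam x u w))) *\<^sub>R xi x
        + (c * G x v w) *\<^sub>R (f x *\<^sub>R u - Gam x u (xi x))"
      by (simp add: fderiv_scaleR[OF s(1) xi_smooth x] fderiv_xi x Gam_metric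
          fderiv_mult[OF smooth_on_const[OF open_U] G_smooth x])
    also have "fderiv (\<lambda>y. (c * G y (xi y) w) *\<^sub>R v) x u =
        (c * (G x (xi x) (Gam x u w) + f x * G x u w)) *\<^sub>R v"
      by (simp add: fderiv_scaleR[OF s(2) smooth_on_const[OF open_U] x] g
          fderiv_mult[OF smooth_on_const[OF open_U] s(3) x])
    finally have d: "dCurv x u v (xi x) w = - Curv x v (fderiv xi x u) w
      + ((c * (G x (Gam x u v) w + G x v (Gam x u w))) *\<^sub>R xi x
        + (c * G x v w) *\<^sub>R (f x *\<^sub>R u - Gam x u (xi x))
        - (c * (G x (xi x) (Gam x u w) + f x * G x u w)) *\<^sub>R v)"
      by (simp add: algebra_simps)
    show ?thesis
      unfolding P_def d fderiv_xi[OF x] Curv_xi_middle[OF x]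
      by (simp add: Gam_simps Curv_simps x algebra_simps)
  qed
  have flip: "dCurv x v (xi x) u w = - dCurv x v u (xi x) w"
  proof -
    have "dCurv x v (xi x) u w = fderiv (\<lambda>y. - Curv y u (xi x) w) x v"
      by (subst Curv_antisym) simp
    also have "\<dots> = - dCurv x v u (xi x) w"
      by (rule fderiv_bounded_linear[OF bounded_linear_minus[OF bounded_linear_ident] Curv_smooth x])
    finally show ?thesis .
  qed
  have "(dCurv x (xi x) u v w + Gam x (xi x) (Curv x u v w) - Curv x u v (Gam x (xi x) w)) + P u v - P v u = 0"
    using second_Bianchi[OF x, where h = "xi x" and u = u and v = v and w = w]
    unfolding P_def flip Curv_antisym[of x "xi x" u]
    by (simp add: Gam_simps x algebra_simps)
  then have "dCurv x (xi x) u v w =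
      - Gam x (xi x) (Curv x u v w) + Curv x u v (Gam x (xi x) w) - P u v + P v u"
    by (simp add: algebra_simps)
  moreover have "Gam x v u = Gam x u v" "Curv x v u w = - Curv x u v w"
    "Gam x u (xi x) = Gam x (xi x) u" "Gam x v (xi x) = Gam x (xi x) v"
    "Curv x v (Gam x (xi x) u) w = - Curv x (Gam x (xi x) u) v w"
    by (rule Gam_sym[OF x] Curv_antisym)+
  ultimately show ?thesis
    unfolding P by (simp add: algebra_simps double)
qed

text \<open>
  The trace removes the commutator of \<open>\<nabla>\<^sub>\<xi>\<close> with the endomorphism \<open>V \<mapsto> Riem(V,v)w\<close>.
\<close>

lemma dRicci_xi:
  assumes x: "x \<in> U"
  shows "fderiv (\<lambda>y. Ricci y v w) x (xi x) =
    Ricci x (Gam x (xi x) v) w + Ricci x v (Gam x (xi x) w)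
    - 2 * (real CARD('n) - 1) * c * f x * G x v w - 2 * f x * Ricci x v w"
proof -
  have "fderiv (\<lambda>y. Ricci y v w) x (xi x) = (\<Sum>i\<in>UNIV. dCurv x (xi x) (axis i 1) v w $ i)"
    unfolding Ricci_def
    by (simp add: fderiv_sum[OF smooth_on_vec_nth[OF open_U Curv_smooth] x] fderiv_vec_nth[OF Curv_smooth x])
  also have "\<dots> = - (\<Sum>i\<in>UNIV. Gam x (xi x) (Curv x (axis i 1) v w) $ i)
    + Ricci x v (Gam x (xi x) w) + (\<Sum>i\<in>UNIV. Curv x (Gam x (xi x) (axis i 1)) v w $ i)
    + Ricci x (Gam x (xi x) v) w
    + 2 * c * f x * ((\<Sum>i\<in>UNIV. G x (axis i 1) w * v $ i) - (\<Sum>i\<in>(UNIV::'n set). G x v w * axis i 1 $ i))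
    - 2 * f x * Ricci x v w"
    unfolding dCurv_xi[OF x] Ricci_def
    by (simp add: sum.distrib sum_subtractf sum_negf sum_distrib_left algebra_simps)
  also have "(\<Sum>i\<in>UNIV. Gam x (xi x) (Curv x (axis i 1) v w) $ i)
      = (\<Sum>i\<in>UNIV. Curv x (Gam x (xi x) (axis i 1)) v w $ i)"
    by (rule trace_compose_commute[OF _ Curv_linear(1)[OF x]])
      (use Gam_bilinear[OF x] in \<open>simp add: bilinear_def\<close>)
  also have "(\<Sum>i\<in>UNIV. G x (axis i 1) w * v $ i) = G x v w"
    by (subst (2) linear_axis_sum[of "\<lambda>v. G x v w"])
      (use G_bilinear[OF x] in \<open>auto simp: bilinear_def mult.commute\<close>)
  also have "(\<Sum>i\<in>(UNIV::'n set). G x v w * axis i 1 $ i) = real CARD('n) * G x v w"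
    by simp
  finally show ?thesis by (simp add: algebra_simps)
qed

text \<open>
  Let \<open>a\<close> be the matrix of \<open>\<nabla>\<^sub>\<xi>\<close> on constant vector fields. The contributions of \<open>a\<close> to the
  derivatives of the inverse metric and of the Ricci form cancel in the trace.
\<close>

theorem dScal_xi:
  assumes x: "x \<in> U"
  shows "fderiv Scal x (xi x) = - 2 * f x * (Scal x + real CARD('n) * (real CARD('n) - 1) * c)"
proof -
  define M where "M = gram x"
  define N where "N y = matrix_inv (gram y)" for y
  define P where "P y = (\<chi> k j. Ricci y (axis j 1) (axis k 1))" for y
  define a :: "real ^ 'n ^ 'n" where "a = (\<chi> l j. Gam x (xi x) (axis j 1) $ l)"
  define dN where "dN = (\<chi> j k. fderiv (\<lambda>y. N y $ j $ k) x (xi x))"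
  define dP where "dP = (\<chi> j k. fderiv (\<lambda>y. P y $ j $ k) x (xi x))"
  define dM where "dM = (\<chi> j k. fderiv (\<lambda>y. gram y $ j $ k) x (xi x))"
  have sN: "smooth_on U (\<lambda>y. N y $ j $ k)" for j k
    unfolding N_def by (rule matrix_inv_gram_smooth)
  have sP: "smooth_on U (\<lambda>y. P y $ j $ k)" for j k
    by (simp add: P_def Ricci_smooth)
  have NM: "N x ** M = mat 1" "M ** N x = mat 1"
    using matrix_inv_inverse[OF invertible_gram[OF x]] by (simp_all add: N_def M_def)
  have Scal_trace: "Scal y = trace (N y ** P y)" for y
    by (simp add: Scal_def trace_def matrix_matrix_mult_def N_def P_def)
  have dScal: "fderiv Scal x (xi x) = trace (dN ** P x) + trace (N x ** dP)"
  proof -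
    have "fderiv Scal x (xi x) = fderiv (\<lambda>y. \<Sum>i\<in>UNIV. \<Sum>k\<in>UNIV. N y $ i $ k * P y $ k $ i) x (xi x)"
      by (simp add: Scal_trace[abs_def] trace_def matrix_matrix_mult_def)
    also have "\<dots> = (\<Sum>i\<in>UNIV. \<Sum>k\<in>UNIV. dN $ i $ k * P x $ k $ i + N x $ i $ k * dP $ k $ i)"
      by (simp add: fderiv_sum[OF smooth_on_sum[OF open_U smooth_on_mult[OF open_U sN sP]] x]
          fderiv_sum[OF smooth_on_mult[OF open_U sN sP] x] fderiv_mult[OF sN sP x] dN_def dP_def)
    finally show ?thesis
      by (simp add: trace_def matrix_matrix_mult_def sum.distrib)
  qed
  have lin: "L (Gam x (xi x) (axis j 1)) = (\<Sum>l\<in>UNIV. a $ l $ j * L (axis l 1))"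
    if "linear L" for L :: "real ^ 'n \<Rightarrow> real" and j
    by (subst linear_axis_sum[OF that]) (simp add: a_def)
  have dM: "dM = transpose a ** M + M ** a"
  proof -
    have "dM $ j $ k = (\<Sum>l\<in>UNIV. a $ l $ j * G x (axis l 1) (axis k 1))
      + (\<Sum>l\<in>UNIV. a $ l $ k * G x (axis j 1) (axis l 1))" for j k
      using lin[of "\<lambda>u. G x u (axis k 1)" j] lin[of "G x (axis j 1)" k] G_bilinear[OF x]
      by (simp add: dM_def gram_def Gam_metric x bilinear_def)
    then show ?thesis
      by (simp add: vec_eq_iff M_def gram_def matrix_matrix_mult_def transpose_def mult.commute)
  qed
  have dP: "dP = P x ** a + transpose a ** P x
      - (2 * (real CARD('n) - 1) * c * f x) *\<^sub>R M - (2 * f x) *\<^sub>R P x"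
  proof -
    have "dP $ k $ j = (\<Sum>l\<in>UNIV. a $ l $ j * Ricci x (axis l 1) (axis k 1))
      + (\<Sum>l\<in>UNIV. a $ l $ k * Ricci x (axis j 1) (axis l 1))
      - 2 * (real CARD('n) - 1) * c * f x * G x (axis k 1) (axis j 1)
      - 2 * f x * Ricci x (axis j 1) (axis k 1)" for j k
      using lin[OF Ricci_linear(1)[OF x, of "axis k 1"], of j] lin[OF Ricci_linear(2)[OF x, of "axis j 1"], of k]
      by (simp add: dP_def P_def dRicci_xi[OF x] G_sym[OF x, of "axis k 1"])
    then show ?thesis
      by (simp add: vec_eq_iff M_def P_def gram_def matrix_matrix_mult_def transpose_def mult.commute)
  qed
  have mat_simps: "(- A) ** B = - (A ** B)" "(A + B) ** D = A ** D + B ** D" "(A - B) ** D = A ** D - B ** D" "D ** (A - B) = D ** A - D ** B"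
    "A ** (r *\<^sub>R B) = r *\<^sub>R (A ** B)"
    for A B D :: "real ^ 'n ^ 'n" and r :: real
    by (simp_all add: vec_eq_iff matrix_matrix_mult_def sum_negf sum_subtractf sum.distrib algebra_simps sum_distrib_left)
  have dN: "dN = - (a ** N x) - N x ** transpose a"
  proof -
    have "dN ** M + N x ** dM = 0"
    proof -
      have "(dN ** M + N x ** dM) $ i $ j = 0" for i j
      proof -
        have "(dN ** M + N x ** dM) $ i $ j =
            fderiv (\<lambda>y. \<Sum>k\<in>UNIV. N y $ i $ k * gram y $ k $ j) x (xi x)"
          by (simp add: fderiv_sum[OF smooth_on_mult[OF open_U sN gram_smooth] x]
              fderiv_mult[OF sN gram_smooth x] dN_def dM_def M_def matrix_matrix_mult_def sum.distrib)
        also have "\<dots> = fderiv (\<lambda>y. (mat 1 :: real ^ 'n ^ 'n) $ i $ j) x (xi x)"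
        proof (subst fderiv_cong[OF open_U smooth_on_sum[OF open_U smooth_on_mult[OF open_U sN gram_smooth]] x])
          show "(\<Sum>k\<in>UNIV. N y $ i $ k * gram y $ k $ j) = (mat 1 :: real ^ 'n ^ 'n) $ i $ j"
            if "y \<in> U" for y
            by (simp add: matrix_inv_inverse(2)[OF invertible_gram[OF that], symmetric]
                matrix_matrix_mult_def N_def)
        qed simp
        finally show ?thesis by simp
      qed
      then show ?thesis by (simp add: vec_eq_iff)
    qed
    then have "(dN ** M + N x ** dM) ** N x = 0"
      by simp
    then have "dN ** (M ** N x) + N x ** (transpose a ** (M ** N x)) + (N x ** M) ** (a ** N x) = 0"
      by (simp add: dM matrix_add_ldistrib mat_simps matrix_mul_assoc add.assoc)
    then have "dN + N x ** transpose a + a ** N x = 0"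
      by (simp add: NM)
    then show ?thesis
      by (metis add.commute add_diff_cancel_left' diff_0)
  qed
  have tr: "trace (- A) = - trace A" "trace (r *\<^sub>R A) = r * trace A" for A :: "real ^ 'n ^ 'n" and r :: real
    by (simp_all add: trace_def sum_negf sum_distrib_left)
  have "fderiv Scal x (xi x) = - trace (a ** (N x ** P x)) - trace (N x ** transpose a ** P x)
     + trace (N x ** P x ** a) + trace (N x ** transpose a ** P x)
     - 2 * (real CARD('n) - 1) * c * f x * trace (N x ** M) - 2 * f x * trace (N x ** P x)"
    unfolding dScal dN dP
    by (simp add: mat_simps tr trace_add trace_sub matrix_add_ldistrib matrix_mul_assoc)
  also have "trace (a ** (N x ** P x)) = trace (N x ** P x ** a)"
    by (rule trace_mul_sym)
  also have "trace (N x ** M) = real CARD('n)"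
    by (simp add: NM trace_I)
  finally show ?thesis
    by (simp add: Scal_trace[of x] algebra_simps)
qed

end

section \<open>Covariant derivatives under changes of coordinates\<close>

lemma trace_conjugate:
  fixes E F J K :: "real ^ 'n \<Rightarrow> real ^ 'n"
  assumes "linear E" "linear J" "linear K" "\<And>v. K (J v) = v" "\<And>v. J (K v) = v"
    and "\<And>v. F (J v) = J (E v)"
  shows "(\<Sum>i\<in>UNIV. F (axis i 1) $ i) = (\<Sum>i\<in>UNIV. E (axis i 1) $ i)"
proof -
  have "linear (\<lambda>v. E (K v))" using linear_compose[OF assms(3,1)] by (simp add: o_def)
  from trace_compose_commute[OF assms(2) this] show ?thesis
    by (simp add: assms(4) assms(6)[symmetric] assms(5))
qed

text \<open>
  Alternating the two symmetries rotates the arguments back to their places in six steps, three of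
  which change the sign.
\<close>

lemma symmetric_skew_zero:
  fixes S :: "'a \<Rightarrow> 'a \<Rightarrow> 'a \<Rightarrow> real"
  assumes sym: "\<And>u v w. u \<in> V \<Longrightarrow> v \<in> V \<Longrightarrow> w \<in> V \<Longrightarrow> S u v w = S v u w"
    and skew: "\<And>u v w. u \<in> V \<Longrightarrow> v \<in> V \<Longrightarrow> w \<in> V \<Longrightarrow> S u v w = - S u w v"
    and "u \<in> V" "v \<in> V" "w \<in> V"
  shows "S u v w = 0"
  using sym[of u v w] skew[of v u w] sym[of v w u] skew[of w v u] sym[of w u v] skew[of u w v] assms(3-)
  by simp

context local_metric
begin

lemma local_metric_subset:
  assumes "open V" "V \<subseteq> U"
  shows "local_metric V G"
proof
  show "bilinear_family V G"
    using assms(2) smooth_on_subset[OF G_smooth assms(2)] G_bilinear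
    by (auto simp: bilinear_family_def linear_family_def bilinear_def)
qed (use assms G_sym G_pos in auto)

text \<open>
  The trace of the endomorphism dual to the Ricci form does not refer to a basis; this form of the
  scalar curvature is the one that is seen to be invariant.
\<close>

lemma Scal_trace: "Scal x = (\<Sum>j\<in>UNIV. sharp x (Ricci x (axis j 1)) $ j)"
  by (simp add: Scal_def sharp_def matrix_vector_mult_def)

definition cov :: "(real ^ 'n \<Rightarrow> real ^ 'n) \<Rightarrow> (real ^ 'n \<Rightarrow> real ^ 'n) \<Rightarrow> real ^ 'n \<Rightarrow> real ^ 'n" where
  "cov X Y x = fderiv Y x (X x) + Gam x (X x) (Y x)"

lemma fderiv_field_smooth:
  "smooth_on U X \<Longrightarrow> smooth_on U Y \<Longrightarrow> smooth_on U (\<lambda>x. fderiv Y x (X x))"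
  by (rule linear_family_smooth[OF open_U linear_family_fderiv_family])

lemma cov_smooth: "smooth_on U X \<Longrightarrow> smooth_on U Y \<Longrightarrow> smooth_on U (cov X Y)"
  unfolding cov_def[abs_def]
  by (intro smooth_on_add open_U fderiv_field_smooth bilinear_family_smooth[OF open_U Gam_family])

lemma cov_metric:
  assumes "smooth_on U X" "smooth_on U Y" "smooth_on U Z" "x \<in> U"
  shows "fderiv (\<lambda>y. G y (Y y) (Z y)) x (X x) = G x (cov X Y x) (Z x) + G x (Y x) (cov X Z x)"
  unfolding bilinear_family_fderiv[OF open_U G_family assms(2,3,4)]
  by (simp add: Gam_metric assms(4) cov_def G_simps)

text \<open>
  Second derivatives of \<open>Z\<close> cancel by symmetry, and the terms with derivatives of \<open>X\<close> and \<open>Y\<close> are those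
  of the covariant derivative along the Lie bracket.
\<close>

lemma cov_commutator:
  assumes X: "smooth_on U X" and Y: "smooth_on U Y" and Z: "smooth_on U Z" and x: "x \<in> U"
  shows "cov X (cov Y Z) x - cov Y (cov X Z) x
      - cov (\<lambda>y. fderiv Y y (X y) - fderiv X y (Y y)) Z x = Curv x (X x) (Y x) (Z x)"
proof -
  have dd: "cov X (cov Y Z) x = fderiv (\<lambda>y. fderiv Z y (Y x)) x (X x) + fderiv Z x (fderiv Y x (X x))
      + dGam x (X x) (Y x) (Z x) + Gam x (fderiv Y x (X x)) (Z x) + Gam x (Y x) (fderiv Z x (X x))
      + Gam x (X x) (fderiv Z x (Y x)) + Gam x (X x) (Gam x (Y x) (Z x))"
    if X: "smooth_on U X" and Y: "smooth_on U Y" for X Y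
  proof -
    have "fderiv (cov Y Z) x (X x) =
        fderiv (\<lambda>y. fderiv Z y (Y y)) x (X x) + fderiv (\<lambda>y. Gam y (Y y) (Z y)) x (X x)"
      unfolding cov_def[abs_def]
      by (rule fderiv_add[OF fderiv_field_smooth[OF Y Z]
            bilinear_family_smooth[OF open_U Gam_family Y Z] x])
    also have "fderiv (\<lambda>y. fderiv Z y (Y y)) x (X x) =
        fderiv (\<lambda>y. fderiv Z y (Y x)) x (X x) + fderiv Z x (fderiv Y x (X x))"
      by (rule linear_family_fderiv[OF open_U linear_family_fderiv_family[OF Z] Y x])
    also have "fderiv (\<lambda>y. Gam y (Y y) (Z y)) x (X x) = dGam x (X x) (Y x) (Z x)
        + Gam x (fderiv Y x (X x)) (Z x) + Gam x (Y x) (fderiv Z x (X x))"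
      by (rule bilinear_family_fderiv[OF open_U Gam_family Y Z x])
    finally show ?thesis by (simp add: cov_def[of _ _ x] Gam_simps x)
  qed
  have "fderiv (\<lambda>y. fderiv Z y (Y x)) x (X x) = fderiv (\<lambda>y. fderiv Z y (X x)) x (Y x)"
    by (rule fderiv_commute[OF open_U x Z])
  then show ?thesis
    unfolding dd[OF X Y] dd[OF Y X]
    by (simp add: cov_def Curv_def Gam_simps x linear_diff[OF smooth_on_linear_fderiv[OF Z x]])
qed

end

text \<open>
  The situation of a transition map between two charts of a Riemannian manifold. The derivative,
  being surjective between spaces of the same dimension, is invertible.
\<close>

locale local_isometry = dom: local_metric U G + cod: local_metric V H
  for U V :: "(real ^ 'n::finite) set" and G H +
  fixes t :: "real ^ 'n \<Rightarrow> real ^ 'n"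
  assumes t_smooth: "smooth_on U t"
    and t_maps: "x \<in> U \<Longrightarrow> t x \<in> V"
    and t_surj: "x \<in> U \<Longrightarrow> surj (fderiv t x)"
    and t_metric: "x \<in> U \<Longrightarrow> H (t x) (fderiv t x u) (fderiv t x v) = G x u v"
begin

lemma H_t_family: "bilinear_family U (\<lambda>x. H (t x))"
  using cod.G_family t_maps smooth_on_compose[OF dom.open_U cod.open_U t_maps t_smooth cod.G_smooth]
  by (auto simp: bilinear_family_def linear_family_def)

lemma fderiv_H_t:
  assumes "x \<in> U"
  shows "fderiv (\<lambda>y. H (t y) u v) x h =
    H (t x) (cod.Gam (t x) (fderiv t x h) u) v + H (t x) u (cod.Gam (t x) (fderiv t x h) v)"
  using fderiv_eqI[OF has_derivative_compose[OF smooth_on_has_fderiv[OF t_smooth assms]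
        smooth_on_has_fderiv[OF cod.G_smooth t_maps[OF assms]]], of u v]
  by (simp add: cod.Gam_metric t_maps assms)

text \<open>
  The difference of the two sides is symmetric in \<open>u\<close> and \<open>v\<close>, and its contraction with a third
  vector is skew, since both connections are metric.
\<close>

lemma Gam_transform:
  assumes x: "x \<in> U"
  shows "fderiv t x (dom.Gam x u v) =
    cod.Gam (t x) (fderiv t x u) (fderiv t x v) + fderiv (\<lambda>y. fderiv t y v) x u"
proof -
  note tx = t_maps[OF x]
  note lin = smooth_on_linear_fderiv[OF t_smooth x]
  define D where "D u v = fderiv t x (dom.Gam x u v)
      - cod.Gam (t x) (fderiv t x u) (fderiv t x v) - fderiv (\<lambda>y. fderiv t y v) x u" for u v
  define S where "S u v w = H (t x) (D u v) (fderiv t x w)" for u v w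
  have "D u v = D v u" for u v
    unfolding D_def dom.Gam_sym[OF x, of v] cod.Gam_sym[OF tx, of "fderiv t x v"]
      fderiv_commute[OF dom.open_U x t_smooth, of u v] ..
  then have sym: "S u v w = S v u w" for u v w
    unfolding S_def by metis
  have skew: "S u v w = - S u w v" for u v w
  proof -
    have "fderiv (\<lambda>y. G y v w) x u = fderiv (\<lambda>y. H (t y) (fderiv t y v) (fderiv t y w)) x u"
      by (subst fderiv_cong[OF dom.open_U dom.G_smooth x t_metric[symmetric]]) simp_all
    also have "\<dots> = fderiv (\<lambda>y. H (t y) (fderiv t x v) (fderiv t x w)) x u
       + H (t x) (fderiv (\<lambda>y. fderiv t y v) x u) (fderiv t x w)
       + H (t x) (fderiv t x v) (fderiv (\<lambda>y. fderiv t y w) x u)"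
      by (rule bilinear_family_fderiv[OF dom.open_U H_t_family smooth_on_fderiv[OF t_smooth]
            smooth_on_fderiv[OF t_smooth] x])
    finally have "G x (dom.Gam x u v) w + G x (dom.Gam x u w) v =
        H (t x) (cod.Gam (t x) (fderiv t x u) (fderiv t x v)) (fderiv t x w)
        + H (t x) (cod.Gam (t x) (fderiv t x u) (fderiv t x w)) (fderiv t x v)
        + H (t x) (fderiv (\<lambda>y. fderiv t y v) x u) (fderiv t x w)
        + H (t x) (fderiv (\<lambda>y. fderiv t y w) x u) (fderiv t x v)"
      unfolding dom.Gam_metric[OF x] fderiv_H_t[OF x] dom.G_sym[OF x, of v]
        cod.G_sym[OF tx, of "fderiv t x v"] by simp
    then show ?thesis
      unfolding S_def D_def t_metric[OF x, symmetric]
      by (simp add: cod.G_simps tx)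
  qed
  have "S u v w = 0" for u v w
    by (rule symmetric_skew_zero[of UNIV S, OF sym skew]) simp_all
  then have "D u v = 0"
    using t_surj[OF x] unfolding S_def
    by (intro cod.G_eqI[OF tx]) (metis bilinear_lzero[OF cod.G_bilinear[OF tx]] surjD)
  then show ?thesis by (simp add: D_def algebra_simps)
qed

text \<open>
  By the chain rule the derivative of the transformed field contains a second derivative of \<open>t\<close>, which
  the transformation law of the Christoffel symbols cancels.
\<close>

lemma cov_transform:
  assumes "smooth_on U Y" "smooth_on V Y'" "x \<in> U"
    and Y: "\<And>y. y \<in> U \<Longrightarrow> Y' (t y) = fderiv t y (Y y)"
    and X: "X' (t x) = fderiv t x (X x)"
  shows "cod.cov X' Y' (t x) = fderiv t x (dom.cov X Y x)"
proof -
  note lin = smooth_on_linear_fderiv[OF t_smooth assms(3)]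
  have "fderiv Y' (t x) (fderiv t x (X x)) = fderiv (\<lambda>y. Y' (t y)) x (X x)"
    using fderiv_eqI[OF has_derivative_compose[OF smooth_on_has_fderiv[OF t_smooth assms(3)]
        smooth_on_has_fderiv[OF assms(2) t_maps[OF assms(3)]]]] by simp
  also have "\<dots> = fderiv (\<lambda>y. fderiv t y (Y y)) x (X x)"
    by (subst fderiv_cong[OF dom.open_U smooth_on_compose[OF dom.open_U cod.open_U t_maps t_smooth assms(2)]
          assms(3) Y]) simp_all
  also have "\<dots> = fderiv (\<lambda>y. fderiv t y (Y x)) x (X x) + fderiv t x (fderiv Y x (X x))"
    by (rule linear_family_fderiv[OF dom.open_U linear_family_fderiv_family[OF t_smooth] assms(1,3)])
  finally show ?thesis
    unfolding cod.cov_def dom.cov_def X linear_add[OF lin] Gam_transform[OF assms(3)] Y[OF assms(3)]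
    by simp
qed

text \<open>
  The endomorphisms dual to the two Ricci forms are conjugate under the derivative of \<open>t\<close>.
\<close>

lemma Scal_transform:
  assumes x: "x \<in> U"
    and Curv: "\<And>u v w. cod.Curv (t x) (fderiv t x u) (fderiv t x v) (fderiv t x w)
       = fderiv t x (dom.Curv x u v w)"
  shows "cod.Scal (t x) = dom.Scal x"
proof -
  define J where "J = fderiv t x"
  note tx = t_maps[OF x]
  have J: "linear J" unfolding J_def by (rule smooth_on_linear_fderiv[OF t_smooth x])
  have surj: "surj J" unfolding J_def by (rule t_surj[OF x])
  have "inj J" using linear_surjective_imp_injective[OF J surj] by simp
  then obtain K where K: "linear K" "\<And>v. K (J v) = v" "\<And>v. J (K v) = v"
    using surj linear_injective_isomorphism[OF J] by metis
  have Ricci: "cod.Ricci (t x) (J v) (J w) = dom.Ricci x v w" for v w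
    unfolding cod.Ricci_def dom.Ricci_def
    by (rule trace_conjugate[OF dom.Curv_linear(1)[OF x] J K]) (simp add: J_def Curv)
  define E where "E v = dom.sharp x (dom.Ricci x v)" for v
  define E' where "E' v = cod.sharp (t x) (cod.Ricci (t x) v)" for v
  have E: "G x (E v) w = dom.Ricci x v w" for v w
    unfolding E_def by (rule dom.G_sharp[OF x dom.Ricci_linear(2)[OF x]])
  have E': "H (t x) (E' v) w = cod.Ricci (t x) v w" for v w
    unfolding E'_def by (rule cod.G_sharp[OF tx cod.Ricci_linear(2)[OF tx]])
  have "linear E"
    by (rule linearI; rule dom.G_eqI[OF x])
      (simp_all add: dom.G_simps x E linear_add[OF dom.Ricci_linear(1)[OF x]]
        linear_scale[OF dom.Ricci_linear(1)[OF x]])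
  moreover have "E' (J v) = J (E v)" for v
  proof (rule cod.G_eqI[OF tx])
    fix w
    have "H (t x) (E' (J v)) (J (K w)) = H (t x) (J (E v)) (J (K w))"
      unfolding E' Ricci unfolding J_def by (simp add: t_metric x E)
    then show "H (t x) (E' (J v)) w = H (t x) (J (E v)) w" by (simp add: K)
  qed
  ultimately have "(\<Sum>i\<in>UNIV. E' (axis i 1) $ i) = (\<Sum>i\<in>UNIV. E (axis i 1) $ i)"
    by (rule trace_conjugate[OF _ J K])
  then show ?thesis
    by (simp add: cod.Scal_trace dom.Scal_trace E_def E'_def)
qed

end

section \<open>Tangent vectors in charts\<close>

context smooth_manifold
begin

lemma chart_openin: "c \<in> A \<Longrightarrow> openin M (fst c)"
  using charts by (auto simp: is_chart_def)

lemma chart_open_image: "c \<in> A \<Longrightarrow> open (snd c ` fst c)"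
  using charts by (auto simp: is_chart_def)

lemma chart_homeomorphic:
  "c \<in> A \<Longrightarrow> homeomorphic_map (subtopology M (fst c)) (top_of_set (snd c ` fst c)) (snd c)"
  using charts by (auto simp: is_chart_def)

lemma chart_topspace: "c \<in> A \<Longrightarrow> topspace (subtopology M (fst c)) = fst c"
  by (rule topspace_subtopology_subset[OF openin_subset[OF chart_openin]])

lemma chart_inj: "c \<in> A \<Longrightarrow> inj_on (snd c) (fst c)"
  using homeomorphic_imp_injective_map[OF chart_homeomorphic] chart_topspace by metis

lemma chart_inv_chart [simp]: "c \<in> A \<Longrightarrow> p \<in> fst c \<Longrightarrow> chart_inv c (snd c p) = p"
  using chart_inj by simp

lemma open_chart_image:
  assumes "c \<in> A" "openin M W"
  shows "open (snd c ` (fst c \<inter> W))"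
proof -
  have "openin (subtopology M (fst c)) (fst c \<inter> W)"
    using assms(2) by (simp add: openin_subtopology_Int2)
  then have "openin (top_of_set (snd c ` fst c)) (snd c ` (fst c \<inter> W))"
    using homeomorphic_map_openness_eq[OF chart_homeomorphic[OF assms(1)]] by blast
  then show ?thesis
    using openin_open_eq[OF chart_open_image[OF assms(1)]] by blast
qed

lemma charts_at_iff: "c \<in> charts_at p \<longleftrightarrow> c \<in> A \<and> p \<in> fst c"
  by (auto simp: charts_at_def)

lemma chart_at:
  assumes "p \<in> topspace M"
  shows "chart_at p \<in> charts_at p"
proof -
  obtain c where "c \<in> charts_at p"
    using assms unfolding cover[symmetric] charts_at_def by blast
  then show ?thesis unfolding chart_at_def by (rule someI)
qed

definition overlap :: "('a, 'n) chart \<Rightarrow> ('a, 'n) chart \<Rightarrow> (real ^ 'n) set" where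
  "overlap c d = snd c ` (fst c \<inter> fst d)"

abbreviation transition :: "('a, 'n) chart \<Rightarrow> ('a, 'n) chart \<Rightarrow> real ^ 'n \<Rightarrow> real ^ 'n" where
  "transition c d x \<equiv> snd d (chart_inv c x)"

lemma open_overlap: "c \<in> A \<Longrightarrow> d \<in> A \<Longrightarrow> open (overlap c d)"
  unfolding overlap_def by (rule open_chart_image[OF _ chart_openin])

lemma transition_smooth: "c \<in> A \<Longrightarrow> d \<in> A \<Longrightarrow> smooth_on (overlap c d) (transition c d)"
  using compatible[of c d] by (simp add: overlap_def o_def)

lemma transition_deriv_eq: "transition_deriv c d p = fderiv (transition c d) (snd c p)"
  by (simp add: transition_deriv_def o_def)

lemma transition_deriv_linear:
  "c \<in> charts_at p \<Longrightarrow> d \<in> charts_at p \<Longrightarrow> linear (transition_deriv c d p)"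
  unfolding transition_deriv_eq
  by (rule smooth_on_linear_fderiv[OF transition_smooth]) (auto simp: charts_at_iff overlap_def)

lemma transition_deriv_cocycle:
  assumes c: "c \<in> charts_at p" and d: "d \<in> charts_at p" and e: "e \<in> charts_at p"
  shows "transition_deriv d e p (transition_deriv c d p u) = transition_deriv c e p u"
proof -
  have cA: "c \<in> A" "p \<in> fst c" and dA: "d \<in> A" "p \<in> fst d" and eA: "e \<in> A" "p \<in> fst e"
    using assms by (auto simp: charts_at_iff)
  define S where "S = snd c ` (fst c \<inter> (fst d \<inter> fst e))"
  have S: "open S" "snd c p \<in> S"
    unfolding S_def using cA dA eA by (auto intro!: open_chart_image chart_openin)
  have 1: "(transition c d has_derivative transition_deriv c d p) (at (snd c p))"
    unfolding transition_deriv_eq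
    by (rule smooth_on_has_fderiv[OF transition_smooth]) (use cA dA in \<open>auto simp: overlap_def\<close>)
  have 2: "(transition d e has_derivative transition_deriv d e p) (at (transition c d (snd c p)))"
    unfolding transition_deriv_eq using cA
    by (simp, intro smooth_on_has_fderiv[OF transition_smooth]) (use dA eA in \<open>auto simp: overlap_def\<close>)
  have "((\<lambda>x. transition d e (transition c d x)) has_derivative
      (\<lambda>u. transition_deriv d e p (transition_deriv c d p u))) (at (snd c p))"
    by (rule has_derivative_compose[OF 1 2])
  then have "(transition c e has_derivative (\<lambda>u. transition_deriv d e p (transition_deriv c d p u))) (at (snd c p))"
    by (rule has_derivative_transform_within_open[OF _ S]) (use cA dA in \<open>auto simp: S_def\<close>)
  then show ?thesis
    unfolding transition_deriv_eq[of c e] by (simp add: fderiv_eqI)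
qed

lemma transition_deriv_id:
  assumes "c \<in> charts_at p"
  shows "transition_deriv c c p u = u"
proof -
  have c: "c \<in> A" "p \<in> fst c" using assms by (auto simp: charts_at_iff)
  have "(transition c c has_derivative (\<lambda>u. u)) (at (snd c p))"
    by (rule has_derivative_transform_within_open[OF has_derivative_ident chart_open_image[OF c(1)]])
      (use c in auto)
  then show ?thesis by (simp add: transition_deriv_eq fderiv_eqI)
qed

text \<open>
  For a standard basis vector \<open>u\<close> this is a coordinate field of \<open>c\<close>. In general it extends an arbitrary
  tangent vector at a point, given by its column \<open>u\<close> in the chart \<open>c\<close>, to a field on the domain of \<open>c\<close>.
\<close>

definition lift :: "('a, 'n) chart \<Rightarrow> real ^ 'n \<Rightarrow> ('a, 'n) vfield" where
  "lift c u p d = (if c \<in> charts_at p \<and> d \<in> charts_at p then transition_deriv c d p u else 0)"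

lemma coord_field_lift: "coord_field c i = lift c (axis i 1)"
  by (intro ext) (simp add: coord_field_def lift_def)

lemma lift_same: "c \<in> charts_at p \<Longrightarrow> lift c u p c = u"
  by (simp add: lift_def transition_deriv_id)

lemma lift_tangent: "c \<in> charts_at p \<Longrightarrow> lift c u p \<in> tangent_space p"
  by (auto simp: tangent_space_def lift_def transition_deriv_cocycle)

lemma tangent_transition:
  "v \<in> tangent_space p \<Longrightarrow> c \<in> charts_at p \<Longrightarrow> d \<in> charts_at p \<Longrightarrow> v d = transition_deriv c d p (v c)"
  unfolding tangent_space_def by blast

lemma tangent_outside: "v \<in> tangent_space p \<Longrightarrow> d \<notin> charts_at p \<Longrightarrow> v d = 0"
  unfolding tangent_space_def by blast

lemma tangent_lift:
  assumes "v \<in> tangent_space p" "c \<in> charts_at p"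
  shows "lift c (v c) p = v"
proof
  fix d
  show "lift c (v c) p d = v d"
    by (cases "d \<in> charts_at p")
      (simp_all add: lift_def assms(2) tangent_transition[OF assms, symmetric] tangent_outside[OF assms(1)])
qed

lemma lift_linear:
  "c \<in> charts_at p \<Longrightarrow> lift c (a *\<^sub>R u + b *\<^sub>R v) p = (\<lambda>d. a *\<^sub>R lift c u p d + b *\<^sub>R lift c v p d)"
  by (intro ext)
    (auto simp: lift_def linear_add[OF transition_deriv_linear] linear_scale[OF transition_deriv_linear])

lemma tangent_eqI:
  "v \<in> tangent_space p \<Longrightarrow> w \<in> tangent_space p \<Longrightarrow> c \<in> charts_at p \<Longrightarrow> v c = w c \<Longrightarrow> v = w"
  using tangent_lift by metis

lemma tangent_combination:
  assumes "u \<in> tangent_space p" "v \<in> tangent_space p"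
  shows "(\<lambda>d. a *\<^sub>R u d + b *\<^sub>R v d) \<in> tangent_space p"
  unfolding tangent_space_def
proof (intro CollectI conjI ballI allI impI)
  fix c d assume cd: "c \<in> charts_at p" "d \<in> charts_at p"
  show "a *\<^sub>R u d + b *\<^sub>R v d = transition_deriv c d p (a *\<^sub>R u c + b *\<^sub>R v c)"
    unfolding tangent_transition[OF assms(1) cd] tangent_transition[OF assms(2) cd]
    by (simp add: linear_add[OF transition_deriv_linear[OF cd]]
        linear_scale[OF transition_deriv_linear[OF cd]])
qed (simp add: tangent_outside[OF assms(1)] tangent_outside[OF assms(2)])

lemma tangent_diff:
  "u \<in> tangent_space p \<Longrightarrow> v \<in> tangent_space p \<Longrightarrow> (\<lambda>d. u d - v d) \<in> tangent_space p"
  using tangent_combination[of u p v 1 "-1"] by simp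

subsection \<open>Vector fields and functions in charts\<close>

abbreviation loc :: "('a, 'n) chart \<Rightarrow> ('a, 'n) vfield \<Rightarrow> real ^ 'n \<Rightarrow> real ^ 'n" where
  "loc c X x \<equiv> X (chart_inv c x) c"

lemma vector_field_tangent: "vector_field W X \<Longrightarrow> p \<in> W \<Longrightarrow> X p \<in> tangent_space p"
  by (simp add: vector_field_def)

lemma vector_field_smooth:
  "vector_field W X \<Longrightarrow> c \<in> A \<Longrightarrow> smooth_on (snd c ` (fst c \<inter> W)) (loc c X)"
  by (simp add: vector_field_def)

lemma vector_field_subset: "vector_field W X \<Longrightarrow> V \<subseteq> W \<Longrightarrow> vector_field V X"
  unfolding vector_field_def by (meson Int_mono image_mono order_refl smooth_on_subset subsetD)

lemma vector_field_lift:
  assumes c: "c \<in> A"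
  shows "vector_field (fst c) (lift c u)"
  unfolding vector_field_def
proof (intro conjI ballI)
  fix p assume "p \<in> fst c"
  then show "lift c u p \<in> tangent_space p" using c by (simp add: lift_tangent charts_at_iff)
next
  fix d assume d: "d \<in> A"
  have "smooth_on (overlap d c) (\<lambda>x. fderiv (transition c d) (transition d c x) u)"
    by (rule smooth_on_compose[OF open_overlap[OF d c] open_overlap[OF c d] _ transition_smooth[OF d c]
          smooth_on_fderiv[OF transition_smooth[OF c d]]])
      (use c d in \<open>auto simp: overlap_def\<close>)
  then have "smooth_on (overlap d c) (loc d (lift c u))"
    by (rule smooth_on_cong[OF open_overlap[OF d c]])
      (use c d in \<open>auto simp: overlap_def lift_def charts_at_iff transition_deriv_eq\<close>)
  then show "smooth_on (snd d ` (fst d \<inter> fst c)) (loc d (lift c u))"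
    by (simp add: overlap_def)
qed

text \<open>
  The chain rule, applied to the transition from the chart that the definition selects.
\<close>

lemma dir_deriv_chart:
  assumes W: "openin M W" "p \<in> W" and f: "smooth_fun W f" and v: "v \<in> tangent_space p"
    and c: "c \<in> charts_at p"
  shows "dir_deriv p v f = fderiv (\<lambda>x. f (chart_inv c x)) (snd c p) (v c)"
proof -
  define d where "d = chart_at p"
  have "p \<in> topspace M" using W openin_subset by blast
  then have dp: "d \<in> charts_at p" unfolding d_def by (rule chart_at)
  have cA: "c \<in> A" "p \<in> fst c" and dA: "d \<in> A" "p \<in> fst d"
    using c dp by (auto simp: charts_at_iff)
  define S where "S = snd d ` (fst d \<inter> (fst c \<inter> W))"
  have S: "open S" "snd d p \<in> S"
    unfolding S_def using cA dA W by (auto intro!: open_chart_image chart_openin)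
  have 1: "(transition d c has_derivative transition_deriv d c p) (at (snd d p))"
    unfolding transition_deriv_eq
    by (rule smooth_on_has_fderiv[OF transition_smooth]) (use cA dA in \<open>auto simp: overlap_def\<close>)
  have sf: "smooth_on (snd c ` (fst c \<inter> W)) (\<lambda>x. f (chart_inv c x))"
    using f cA by (simp add: smooth_fun_def o_def)
  have 2: "((\<lambda>x. f (chart_inv c x)) has_derivative fderiv (\<lambda>x. f (chart_inv c x)) (snd c p)) (at (transition d c (snd d p)))"
    using smooth_on_has_fderiv[OF sf, of "snd c p"] cA dA W by simp
  have "((\<lambda>x. f (chart_inv c (transition d c x))) has_derivative
      (\<lambda>u. fderiv (\<lambda>x. f (chart_inv c x)) (snd c p) (transition_deriv d c p u))) (at (snd d p))"
    by (rule has_derivative_compose[OF 1 2])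
  then have "((\<lambda>x. f (chart_inv d x)) has_derivative
      (\<lambda>u. fderiv (\<lambda>x. f (chart_inv c x)) (snd c p) (transition_deriv d c p u))) (at (snd d p))"
    by (rule has_derivative_transform_within_open[OF _ S]) (use cA dA in \<open>auto simp: S_def\<close>)
  then show ?thesis
    unfolding dir_deriv_def Let_def d_def[symmetric] o_def
    by (simp add: fderiv_eqI tangent_transition[OF v dp c])
qed

end

section \<open>The Levi-Civita connection\<close>

context riemannian_manifold
begin

definition gloc :: "('a, 'n) chart \<Rightarrow> real ^ 'n \<Rightarrow> real ^ 'n \<Rightarrow> real ^ 'n \<Rightarrow> real" where
  "gloc c x u v = g (chart_inv c x) (lift c u (chart_inv c x)) (lift c v (chart_inv c x))"

abbreviation covc :: "('a, 'n) chart \<Rightarrow> (real ^ 'n \<Rightarrow> real ^ 'n) \<Rightarrow> (real ^ 'n \<Rightarrow> real ^ 'n) \<Rightarrow> real ^ 'n \<Rightarrow> real ^ 'n"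
  where "covc c \<equiv> local_metric.cov (gloc c)"

lemma gloc_eq:
  assumes "p \<in> topspace M" "c \<in> charts_at p" "v \<in> tangent_space p" "w \<in> tangent_space p"
  shows "g p v w = gloc c (snd c p) (v c) (w c)"
  using assms by (simp add: gloc_def tangent_lift charts_at_iff)

lemma charts_at_topspace: "c \<in> charts_at p \<Longrightarrow> p \<in> topspace M"
  by (meson charts_at_iff chart_openin openin_subset subsetD)

lemma chart_point:
  assumes "c \<in> A" "x \<in> snd c ` (fst c \<inter> W)"
  shows "c \<in> charts_at (chart_inv c x)" "snd c (chart_inv c x) = x" "chart_inv c x \<in> W"
  using assms by (auto simp: charts_at_iff)

lemma chart_point':
  assumes "c \<in> A" "x \<in> snd c ` fst c"
  shows "c \<in> charts_at (chart_inv c x)" "snd c (chart_inv c x) = x"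
  using assms by (auto simp: charts_at_iff)

lemma local_metric_chart:
  assumes c: "c \<in> A"
  shows "local_metric (snd c ` fst c) (gloc c)"
proof
  show op: "open (snd c ` fst c)" by (rule chart_open_image[OF c])
  show sym: "gloc c x u v = gloc c x v u" if "x \<in> snd c ` fst c" for x u v
    unfolding gloc_def
    by (intro metric_sym lift_tangent charts_at_topspace[of c] chart_point'(1)[OF c that])
  show "0 < gloc c x v v" if "x \<in> snd c ` fst c" "v \<noteq> 0" for x v
    unfolding gloc_def
  proof (intro metric_pos lift_tangent charts_at_topspace[of c] chart_point'(1)[OF c that(1)])
    show "lift c v (chart_inv c x) \<noteq> (\<lambda>c. 0)"
      using lift_same[OF chart_point'(1)[OF c that(1)], of v] that(2) by metis
  qed
  have sm: "smooth_on (snd c ` fst c) (\<lambda>x. gloc c x u v)" for u v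
    using metric_smooth[OF chart_openin[OF c] vector_field_lift[OF c] vector_field_lift[OF c],
        unfolded smooth_fun_def, THEN bspec, OF c, of u v]
    by (simp add: gloc_def o_def)
  have lin: "linear (\<lambda>u. gloc c x u v)" if "x \<in> snd c ` fst c" for x v
  proof -
    note cx = chart_point'(1)[OF c that]
    have "gloc c x (a *\<^sub>R u + b *\<^sub>R w) v = a * gloc c x u v + b * gloc c x w v" for a b u w
      unfolding gloc_def lift_linear[OF cx]
      by (intro metric_linear lift_tangent charts_at_topspace[OF cx] cx)
    from this[of 1 _ 1] this[of _ _ 0] show ?thesis
      by (intro linearI) simp_all
  qed
  moreover have "linear (gloc c x v)" if "x \<in> snd c ` fst c" for x v
    using lin[OF that, of v] by (simp add: sym[OF that, of _ v])
  ultimately show "bilinear_family (snd c ` fst c) (gloc c)"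
    using sm by (simp add: bilinear_family_def linear_family_def)
qed

lemma local_metric_chart_on:
  assumes "c \<in> A" "openin M W"
  shows "local_metric (snd c ` (fst c \<inter> W)) (gloc c)"
  by (rule local_metric.local_metric_subset[OF local_metric_chart[OF assms(1)] open_chart_image[OF assms]]) auto

lemma local_isometry_chart:
  assumes c: "c \<in> A" and d: "d \<in> A" and W: "openin M W"
  shows "local_isometry (snd c ` (fst c \<inter> (fst d \<inter> W))) (snd d ` (fst d \<inter> (fst c \<inter> W)))
    (gloc c) (gloc d) (transition c d)" (is "local_isometry ?U ?V _ _ _")
proof (rule local_isometry.intro[OF local_metric_chart_on local_metric_chart_on local_isometry_axioms.intro])
  have sub: "?U \<subseteq> overlap c d" by (auto simp: overlap_def)
  show "smooth_on ?U (transition c d)"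
    by (rule smooth_on_subset[OF transition_smooth[OF c d] sub])
  show "transition c d x \<in> ?V" if "x \<in> ?U" for x
    using that c d by auto
  have at: "c \<in> charts_at (chart_inv c x)" "d \<in> charts_at (chart_inv c x)" "snd c (chart_inv c x) = x"
    if "x \<in> ?U" for x
    using that c d by (auto simp: charts_at_iff)
  have td: "fderiv (transition c d) x = transition_deriv c d (chart_inv c x)" if "x \<in> ?U" for x
    unfolding transition_deriv_eq at(3)[OF that] ..
  show "surj (fderiv (transition c d) x)" if "x \<in> ?U" for x
    unfolding td[OF that]
    by (rule surjI[where f = "transition_deriv d c (chart_inv c x)"])
      (simp add: transition_deriv_cocycle transition_deriv_id at[OF that])
  show "gloc d (transition c d x) (fderiv (transition c d) x u) (fderiv (transition c d) x v) = gloc c x u v"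
    if "x \<in> ?U" for x u v
  proof -
    note a = at[OF that]
    have "gloc c x u v = gloc d (snd d (chart_inv c x)) (lift c u (chart_inv c x) d) (lift c v (chart_inv c x) d)"
      unfolding gloc_def[of c]
      by (intro gloc_eq charts_at_topspace[OF a(1)] a lift_tangent)
    then show ?thesis unfolding td[OF that] by (simp add: lift_def a)
  qed
qed (intro c d W openin_Int chart_openin)+

text \<open>
  The connection given by the Christoffel symbols of each chart. That its columns in different
  charts fit together is the transformation law of the Christoffel symbols.
\<close>

definition conn :: "('a, 'n) vfield \<Rightarrow> ('a, 'n) vfield \<Rightarrow> ('a, 'n) vfield" where
  "conn X Y p c = (if c \<in> charts_at p then covc c (loc c X) (loc c Y) (snd c p) else 0)"

lemma vector_field_conn:
  assumes W: "openin M W" and X: "vector_field W X" and Y: "vector_field W Y"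
  shows "vector_field W (conn X Y)"
  unfolding vector_field_def
proof (intro conjI ballI)
  fix p assume p: "p \<in> W"
  show "conn X Y p \<in> tangent_space p"
    unfolding tangent_space_def
  proof (intro CollectI conjI ballI allI impI)
    fix c d assume cd: "c \<in> charts_at p" "d \<in> charts_at p"
    then have cA: "c \<in> A" "p \<in> fst c" and dA: "d \<in> A" "p \<in> fst d" by (auto simp: charts_at_iff)
    interpret local_isometry "snd c ` (fst c \<inter> (fst d \<inter> W))" "snd d ` (fst d \<inter> (fst c \<inter> W))"
      "gloc c" "gloc d" "transition c d"
      by (rule local_isometry_chart[OF cA(1) dA(1) W])
    have x: "snd c p \<in> snd c ` (fst c \<inter> (fst d \<inter> W))" using cA dA p by auto
    have tr: "loc d Z (transition c d y) = fderiv (transition c d) y (loc c Z y)"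
      if y: "y \<in> snd c ` (fst c \<inter> (fst d \<inter> W))" and Z: "vector_field W Z" for y Z
    proof -
      obtain q where q: "q \<in> fst c" "q \<in> fst d" "q \<in> W" "y = snd c q" using y by blast
      then show ?thesis
        using tangent_transition[OF vector_field_tangent[OF Z q(3)], of c d] cA dA
        by (simp add: charts_at_iff transition_deriv_eq)
    qed
    have "covc d (loc d X) (loc d Y) (transition c d (snd c p)) =
        fderiv (transition c d) (snd c p) (covc c (loc c X) (loc c Y) (snd c p))"
    proof (rule cov_transform[OF _ _ x])
      show "smooth_on (snd c ` (fst c \<inter> (fst d \<inter> W))) (loc c Y)"
        by (rule smooth_on_subset[OF vector_field_smooth[OF Y cA(1)]]) auto
      show "smooth_on (snd d ` (fst d \<inter> (fst c \<inter> W))) (loc d Y)"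
        by (rule smooth_on_subset[OF vector_field_smooth[OF Y dA(1)]]) auto
    qed (use tr X Y x in auto)
    then show "conn X Y p d = transition_deriv c d p (conn X Y p c)"
      using cd cA by (simp add: conn_def transition_deriv_eq)
  qed (simp add: conn_def)
next
  fix c assume c: "c \<in> A"
  let ?V = "snd c ` (fst c \<inter> W)"
  interpret local_metric ?V "gloc c" by (rule local_metric_chart_on[OF c W])
  have "smooth_on ?V (covc c (loc c X) (loc c Y))"
    by (intro cov_smooth vector_field_smooth X Y c)
  then show "smooth_on ?V (loc c (conn X Y))"
    by (rule smooth_on_cong[OF open_U]) (use c in \<open>auto simp: conn_def charts_at_iff\<close>)
qed

lemma inner_vf_chart:
  assumes "c \<in> A" "openin M W" "vector_field W Y" "vector_field W Z" "x \<in> snd c ` (fst c \<inter> W)"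
  shows "inner_vf Y Z (chart_inv c x) = gloc c x (loc c Y x) (loc c Z x)"
proof -
  note cp = chart_point[OF assms(1,5)]
  show ?thesis
    unfolding inner_vf_def
    using gloc_eq[OF charts_at_topspace[OF cp(1)] cp(1) vector_field_tangent[OF assms(3) cp(3)]
        vector_field_tangent[OF assms(4) cp(3)]]
    by (simp add: cp(2))
qed

lemma affine_connection_conn: "affine_connection conn"
  unfolding affine_connection_def
proof (intro allI impI conjI ballI)
  fix W X Y Z f
  assume "openin M W \<and> vector_field W X \<and> vector_field W Y \<and> vector_field W Z \<and> smooth_fun W f"
  then have W: "openin M W" and X: "vector_field W X" and Y: "vector_field W Y"
    and Z: "vector_field W Z" and f: "smooth_fun W f" by auto
  show "vector_field W (conn X Y)" by (rule vector_field_conn[OF W X Y])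
  fix p assume p: "p \<in> W"
  show "conn (\<lambda>q c. f q *\<^sub>R X q c + Y q c) Z p = (\<lambda>c. f p *\<^sub>R conn X Z p c + conn Y Z p c)"
  proof
    fix d
    show "conn (\<lambda>q c. f q *\<^sub>R X q c + Y q c) Z p d = f p *\<^sub>R conn X Z p d + conn Y Z p d"
    proof (cases "d \<in> charts_at p")
      case True
      then have d: "d \<in> A" "p \<in> fst d" by (auto simp: charts_at_iff)
      let ?V = "snd d ` (fst d \<inter> W)"
      interpret local_metric ?V "gloc d" by (rule local_metric_chart_on[OF d(1) W])
      have x: "snd d p \<in> ?V" using d p by auto
      note lin = smooth_on_linear_fderiv[OF vector_field_smooth[OF Z d(1)] x]
      show ?thesis
        using True d
        by (simp add: conn_def cov_def linear_add[OF lin] linear_scale[OF lin] Gam_simps x algebra_simps)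
    qed (simp add: conn_def)
  qed
  show "conn X (\<lambda>q c. f q *\<^sub>R Y q c + Z q c) p =
      (\<lambda>c. vf_apply X f p *\<^sub>R Y p c + f p *\<^sub>R conn X Y p c + conn X Z p c)"
  proof
    fix d
    show "conn X (\<lambda>q c. f q *\<^sub>R Y q c + Z q c) p d =
      vf_apply X f p *\<^sub>R Y p d + f p *\<^sub>R conn X Y p d + conn X Z p d"
    proof (cases "d \<in> charts_at p")
      case True
      then have d: "d \<in> A" "p \<in> fst d" by (auto simp: charts_at_iff)
      let ?V = "snd d ` (fst d \<inter> W)"
      interpret local_metric ?V "gloc d" by (rule local_metric_chart_on[OF d(1) W])
      have x: "snd d p \<in> ?V" using d p by auto
      have sf: "smooth_on ?V (\<lambda>x. f (chart_inv d x))"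
        using f d by (simp add: smooth_fun_def o_def)
      note sY = vector_field_smooth[OF Y d(1)] and sZ = vector_field_smooth[OF Z d(1)]
      have "vf_apply X f p = fderiv (\<lambda>x. f (chart_inv d x)) (snd d p) (X p d)"
        unfolding vf_apply_def by (rule dir_deriv_chart[OF W p f vector_field_tangent[OF X p] True])
      moreover have "fderiv (\<lambda>x. f (chart_inv d x) *\<^sub>R loc d Y x + loc d Z x) (snd d p) (X p d) =
          fderiv (\<lambda>x. f (chart_inv d x)) (snd d p) (X p d) *\<^sub>R Y p d
          + f p *\<^sub>R fderiv (loc d Y) (snd d p) (X p d) + fderiv (loc d Z) (snd d p) (X p d)"
        using d by (simp add: fderiv_add[OF smooth_on_scaleR[OF open_U sf sY] sZ x] fderiv_scaleR[OF sf sY x])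
      ultimately show ?thesis
        using True d by (simp add: conn_def cov_def Gam_simps x scaleR_add_right)
    next
      case False
      then show ?thesis
        using tangent_outside[OF vector_field_tangent[OF Y p]] by (simp add: conn_def)
    qed
  qed
qed

lemma levi_civita_conn: "levi_civita_connection conn"
  unfolding levi_civita_connection_def
proof (intro allI impI conjI ballI affine_connection_conn)
  fix W X Y Z p
  assume "openin M W \<and> vector_field W X \<and> vector_field W Y \<and> vector_field W Z"
  then have W: "openin M W" and X: "vector_field W X" and Y: "vector_field W Y"
    and Z: "vector_field W Z" by auto
  assume p: "p \<in> W"
  show "(\<lambda>c. conn X Y p c - conn Y X p c) = lie_bracket X Y p"
  proof
    fix c
    show "conn X Y p c - conn Y X p c = lie_bracket X Y p c"
    proof (cases "c \<in> charts_at p")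
      case True
      then have c: "c \<in> A" "p \<in> fst c" by (auto simp: charts_at_iff)
      interpret local_metric "snd c ` fst c" "gloc c" by (rule local_metric_chart[OF c(1)])
      have x: "snd c p \<in> snd c ` fst c" using c by auto
      show ?thesis
        using True c Gam_sym[OF x, of "X p c" "Y p c"]
        by (simp add: conn_def cov_def lie_bracket_def)
    qed (simp add: conn_def lie_bracket_def)
  qed
  define c where "c = chart_at p"
  have cp: "c \<in> charts_at p"
    unfolding c_def using p openin_subset[OF W] by (intro chart_at) auto
  then have c: "c \<in> A" "p \<in> fst c" by (auto simp: charts_at_iff)
  let ?V = "snd c ` (fst c \<inter> W)"
  interpret local_metric ?V "gloc c" by (rule local_metric_chart_on[OF c(1) W])
  have x: "snd c p \<in> ?V" using c p by auto
  note smooth = vector_field_smooth[OF X c(1)] vector_field_smooth[OF Y c(1)] vector_field_smooth[OF Z c(1)]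
  have "vf_apply X (inner_vf Y Z) p = fderiv (\<lambda>x. inner_vf Y Z (chart_inv c x)) (snd c p) (X p c)"
    unfolding vf_apply_def dir_deriv_def c_def Let_def o_def ..
  also have "\<dots> = fderiv (\<lambda>x. gloc c x (loc c Y x) (loc c Z x)) (snd c p) (loc c X (snd c p))"
    using c
    by (subst fderiv_cong[OF open_U bilinear_family_smooth[OF open_U G_family smooth(2,3)] x
          inner_vf_chart[OF c(1) W Y Z, symmetric]]) simp_all
  also have "\<dots> = gloc c (snd c p) (conn X Y p c) (Z p c) + gloc c (snd c p) (Y p c) (conn X Z p c)"
    using cov_metric[OF smooth x] c cp by (simp add: conn_def)
  also have "\<dots> = inner_vf (conn X Y) Z p + inner_vf Y (conn X Z) p"
    unfolding inner_vf_def
    using gloc_eq[OF charts_at_topspace[OF cp] cp] vector_field_tangent[OF vector_field_conn[OF W X Y] p]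
      vector_field_tangent[OF vector_field_conn[OF W X Z] p] vector_field_tangent[OF Y p] vector_field_tangent[OF Z p]
    by simp
  finally show "vf_apply X (inner_vf Y Z) p = inner_vf (conn X Y) Z p + inner_vf Y (conn X Z) p" .
qed

lemma levi_civitaD:
  assumes D: "levi_civita_connection D" and W: "openin M W"
    and X: "vector_field W X" and Y: "vector_field W Y"
  shows "vector_field W (D X Y)"
    and "p \<in> W \<Longrightarrow> (\<lambda>c. D X Y p c - D Y X p c) = lie_bracket X Y p"
    and "p \<in> W \<Longrightarrow> vector_field W Z \<Longrightarrow>
      vf_apply X (inner_vf Y Z) p = inner_vf (D X Y) Z p + inner_vf Y (D X Z) p"
proof -
  have "smooth_fun W (\<lambda>x. 0)"
    using open_chart_image[OF _ W] by (auto simp: smooth_fun_def o_def intro!: smooth_on_const)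
  moreover have "affine_connection D" using D by (simp add: levi_civita_connection_def)
  ultimately show "vector_field W (D X Y)"
    unfolding affine_connection_def using W X Y by blast
  have *: "\<forall>W X Y Z. openin M W \<and> vector_field W X \<and> vector_field W Y \<and> vector_field W Z \<longrightarrow>
        (\<forall>p\<in>W. (\<lambda>c. D X Y p c - D Y X p c) = lie_bracket X Y p \<and>
           vf_apply X (inner_vf Y Z) p = inner_vf (D X Y) Z p + inner_vf Y (D X Z) p)"
    using D by (simp add: levi_civita_connection_def)
  show "p \<in> W \<Longrightarrow> (\<lambda>c. D X Y p c - D Y X p c) = lie_bracket X Y p"
    using *[rule_format, of W X Y Y p] W X Y by simp
  show "p \<in> W \<Longrightarrow> vector_field W Z \<Longrightarrow>
      vf_apply X (inner_vf Y Z) p = inner_vf (D X Y) Z p + inner_vf Y (D X Z) p"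
    using *[rule_format, of W X Y Z p] W X Y by simp
qed

text \<open>
  The difference of two Levi-Civita connections is a tensor that is symmetric in its two arguments
  and, because both connections are metric, skew with respect to the metric.
\<close>

lemma levi_civita_unique:
  assumes D: "levi_civita_connection D" and E: "levi_civita_connection E"
    and W: "openin M W" and X: "vector_field W X" and Y: "vector_field W Y" and p: "p \<in> W"
  shows "D X Y p = E X Y p"
proof -
  define c where "c = chart_at p"
  have pM: "p \<in> topspace M" using p openin_subset[OF W] by auto
  have cp: "c \<in> charts_at p" unfolding c_def by (rule chart_at[OF pM])
  then have c: "c \<in> A" "p \<in> fst c" by (auto simp: charts_at_iff)
  define V where "V = W \<inter> fst c"
  have V: "openin M V" "p \<in> V"
    unfolding V_def using p c by (auto intro!: openin_Int W chart_openin)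
  define F where "F = {X. vector_field V X}"
  have field: "D X Y p \<in> tangent_space p" "E X Y p \<in> tangent_space p" if "X \<in> F" "Y \<in> F" for X Y
    using that levi_civitaD(1)[OF D V(1)] levi_civitaD(1)[OF E V(1)] vector_field_tangent[OF _ V(2)]
    by (auto simp: F_def)
  define B where "B X Y = (\<lambda>c. D X Y p c - E X Y p c)" for X Y
  have BT: "B X Y \<in> tangent_space p" if "X \<in> F" "Y \<in> F" for X Y
    unfolding B_def by (intro tangent_diff field that)
  have FT: "X p \<in> tangent_space p" if "X \<in> F" for X
    using that V vector_field_tangent by (auto simp: F_def)
  have g_diff: "g p (B X Y) w = g p (D X Y p) w - g p (E X Y p) w"
    if "X \<in> F" "Y \<in> F" "w \<in> tangent_space p" for X Y w
    using metric_linear[OF pM field(1)[OF that(1,2)] field(2)[OF that(1,2)] that(3), of 1 "-1"]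
    by (simp add: B_def)
  define S where "S X Y Z = g p (B X Y) (Z p)" for X Y Z
  have sym: "S X Y Z = S Y X Z" if "X \<in> F" "Y \<in> F" "Z \<in> F" for X Y Z
  proof -
    have "(\<lambda>c. D X Y p c - D Y X p c) = (\<lambda>c. E X Y p c - E Y X p c)"
      using that levi_civitaD(2)[OF D V(1) _ _ V(2)] levi_civitaD(2)[OF E V(1) _ _ V(2)]
      by (simp add: F_def)
    then have "B X Y = B Y X"
      unfolding B_def by (intro ext) (drule fun_cong, simp add: algebra_simps)
    then show ?thesis by (simp add: S_def)
  qed
  have skew: "S X Y Z = - S X Z Y" if "X \<in> F" "Y \<in> F" "Z \<in> F" for X Y Z
  proof -
    have "inner_vf (D X Y) Z p + inner_vf Y (D X Z) p = inner_vf (E X Y) Z p + inner_vf Y (E X Z) p"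
      using that levi_civitaD(3)[OF D V(1) _ _ V(2), of X Y Z] levi_civitaD(3)[OF E V(1) _ _ V(2), of X Y Z]
      by (simp add: F_def)
    then show ?thesis
      using that metric_sym[OF pM FT[OF that(2)] field(1)[OF that(1,3)]]
        metric_sym[OF pM FT[OF that(2)] field(2)[OF that(1,3)]]
      by (simp add: S_def g_diff FT inner_vf_def)
  qed
  have XY: "X \<in> F" "Y \<in> F"
    using X Y vector_field_subset by (auto simp: F_def V_def)
  \<comment> \<open>A field that extends the vector \<open>B X Y\<close> may take the place of \<open>Z\<close>.\<close>
  let ?Z = "lift c (B X Y c)"
  have "?Z \<in> F"
    using vector_field_subset[OF vector_field_lift[OF c(1)]] by (auto simp: F_def V_def)
  then have "S X Y ?Z = 0"
    by (intro symmetric_skew_zero[of F S, OF sym skew] XY)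
  then have "g p (B X Y) (B X Y) = 0"
    by (simp add: S_def tangent_lift[OF BT[OF XY] cp])
  then have "B X Y = (\<lambda>c. 0)"
    using metric_pos[OF pM BT[OF XY]] by fastforce
  then show ?thesis
    unfolding B_def by (intro ext) (drule fun_cong, simp)
qed

lemma levi_civita_nabla: "levi_civita_connection nabla"
  unfolding nabla_def by (rule someI[of levi_civita_connection, OF levi_civita_conn])

lemma nabla_conn:
  "openin M W \<Longrightarrow> vector_field W X \<Longrightarrow> vector_field W Y \<Longrightarrow> p \<in> W \<Longrightarrow> nabla X Y p = conn X Y p"
  by (rule levi_civita_unique[OF levi_civita_nabla levi_civita_conn])

section \<open>Curvature in charts\<close>

lemma vector_field_cong:
  assumes "openin M W" "vector_field W X" "\<And>p. p \<in> W \<Longrightarrow> X p = Y p"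
  shows "vector_field W Y"
  unfolding vector_field_def
proof (intro conjI ballI)
  show "Y p \<in> tangent_space p" if "p \<in> W" for p
    using vector_field_tangent[OF assms(2) that] assms(3)[OF that] by simp
  show "smooth_on (snd c ` (fst c \<inter> W)) (loc c Y)" if "c \<in> A" for c
    by (rule smooth_on_cong[OF open_chart_image[OF that assms(1)] vector_field_smooth[OF assms(2) that]])
      (use that assms(3) in auto)
qed

lemma vector_field_nabla:
  assumes "openin M W" "vector_field W X" "vector_field W Y"
  shows "vector_field W (nabla X Y)"
  by (rule vector_field_cong[OF assms(1) vector_field_conn[OF assms]]) (simp add: nabla_conn[OF assms])

lemma loc_nabla:
  assumes "openin M W" "vector_field W X" "vector_field W Y" "c \<in> A" "x \<in> snd c ` (fst c \<inter> W)"
  shows "loc c (nabla X Y) x = covc c (loc c X) (loc c Y) x"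
  using nabla_conn[OF assms(1-3) chart_point(3)[OF assms(4,5)]]
  by (simp add: conn_def chart_point[OF assms(4,5)])

lemma loc_lie_bracket:
  assumes "c \<in> A" "x \<in> snd c ` (fst c \<inter> W)"
  shows "loc c (lie_bracket X Y) x = fderiv (loc c Y) x (loc c X x) - fderiv (loc c X) x (loc c Y x)"
  by (simp add: lie_bracket_def chart_point[OF assms])

lemma vector_field_lie_bracket:
  assumes W: "openin M W" and X: "vector_field W X" and Y: "vector_field W Y"
  shows "vector_field W (lie_bracket X Y)"
proof (rule vector_field_cong[OF W])
  show "(\<lambda>c. conn X Y p c - conn Y X p c) = lie_bracket X Y p" if "p \<in> W" for p
    by (rule levi_civitaD(2)[OF levi_civita_conn W X Y that])
  show "vector_field W (\<lambda>p c. conn X Y p c - conn Y X p c)"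
    unfolding vector_field_def
  proof (intro conjI ballI)
    fix p assume "p \<in> W"
    then show "(\<lambda>c. conn X Y p c - conn Y X p c) \<in> tangent_space p"
      by (intro tangent_diff vector_field_tangent[OF vector_field_conn[OF W X Y]]
          vector_field_tangent[OF vector_field_conn[OF W Y X]])
  next
    fix c assume "c \<in> A"
    then show "smooth_on (snd c ` (fst c \<inter> W)) (\<lambda>x. conn X Y (chart_inv c x) c - conn Y X (chart_inv c x) c)"
      by (intro smooth_on_diff open_chart_image vector_field_smooth[OF vector_field_conn] W X Y)
  qed
qed

text \<open>
  All vector fields are admitted, because the coordinate fields of one chart are not constant in the
  others.
\<close>

lemma riemann_chart:
  assumes W: "openin M W" and X: "vector_field W X" and Y: "vector_field W Y" and Z: "vector_field W Z"
    and p: "p \<in> W" and cp: "c \<in> charts_at p"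
  shows "riemann X Y Z p c = local_metric.Curv (gloc c) (snd c p) (X p c) (Y p c) (Z p c)"
proof -
  have c: "c \<in> A" "p \<in> fst c" using cp by (auto simp: charts_at_iff)
  let ?V = "snd c ` (fst c \<inter> W)"
  interpret local_metric ?V "gloc c" by (rule local_metric_chart_on[OF c(1) W])
  have x: "snd c p \<in> ?V" using c p by auto
  note smooth = vector_field_smooth[OF X c(1)] vector_field_smooth[OF Y c(1)] vector_field_smooth[OF Z c(1)]
  have nn: "nabla X (nabla Y Z) p c = cov (loc c X) (cov (loc c Y) (loc c Z)) (snd c p)"
    if X: "vector_field W X" and Y: "vector_field W Y" for X Y
  proof -
    have "nabla X (nabla Y Z) p c = cov (loc c X) (loc c (nabla Y Z)) (snd c p)"
      using loc_nabla[OF W X vector_field_nabla[OF W Y Z] c(1) x] c by simp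
    also have "\<dots> = cov (loc c X) (cov (loc c Y) (loc c Z)) (snd c p)"
      using fderiv_cong[OF open_U vector_field_smooth[OF vector_field_nabla[OF W Y Z] c(1)] x
          loc_nabla[OF W Y Z c(1)]] loc_nabla[OF W Y Z c(1) x]
      by (simp add: cov_def[of "loc c X"])
    finally show ?thesis .
  qed
  have "nabla (lie_bracket X Y) Z p c = cov (loc c (lie_bracket X Y)) (loc c Z) (snd c p)"
    using loc_nabla[OF W vector_field_lie_bracket[OF W X Y] Z c(1) x] c by simp
  also have "\<dots> = cov (\<lambda>y. fderiv (loc c Y) y (loc c X y) - fderiv (loc c X) y (loc c Y y)) (loc c Z) (snd c p)"
    unfolding cov_def loc_lie_bracket[OF c(1) x] ..
  finally have "riemann X Y Z p c = Curv (snd c p) (loc c X (snd c p)) (loc c Y (snd c p)) (loc c Z (snd c p))"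
    unfolding riemann_def nn[OF X Y] nn[OF Y X]
    using cov_commutator[OF smooth x] by simp
  then show ?thesis using c by simp
qed

lemma riemann_tangent:
  assumes W: "openin M W" and X: "vector_field W X" and Y: "vector_field W Y" and Z: "vector_field W Z"
    and p: "p \<in> W"
  shows "riemann X Y Z p \<in> tangent_space p"
  unfolding riemann_def
  by (intro tangent_diff vector_field_tangent[OF vector_field_nabla[OF W] p] vector_field_nabla
      vector_field_lie_bracket W X Y Z)

lemma Curv_transform:
  assumes "c \<in> charts_at p" "d \<in> charts_at p"
  shows "local_metric.Curv (gloc d) (snd d p) (transition_deriv c d p u) (transition_deriv c d p v) (transition_deriv c d p w)
    = transition_deriv c d p (local_metric.Curv (gloc c) (snd c p) u v w)"
proof -
  have c: "c \<in> A" "p \<in> fst c" using assms by (auto simp: charts_at_iff)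
  note l = vector_field_lift[OF c(1)]
  note R = riemann_chart[OF chart_openin[OF c(1)] l l l c(2), of _ u v w]
  have "riemann (lift c u) (lift c v) (lift c w) p d =
      transition_deriv c d p (riemann (lift c u) (lift c v) (lift c w) p c)"
    by (rule tangent_transition[OF riemann_tangent[OF chart_openin[OF c(1)] l l l c(2)] assms])
  then show ?thesis
    unfolding R[OF assms(1)] R[OF assms(2)]
    by (simp add: lift_same[OF assms(1)]) (simp add: lift_def assms)
qed

text \<open>
  The formula for the curvature in a chart holds for all vector fields, not only for the coordinate
  fields of that chart. Applied to the coordinate fields of another chart, it shows that the curvature
  expressions of the two charts correspond under the transition map.
\<close>

lemma scalar_curvature_chart:
  assumes cp: "c \<in> charts_at p"
  shows "scalar_curvature p = local_metric.Scal (gloc c) (snd c p)"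
proof -
  define d where "d = chart_at p"
  have pM: "p \<in> topspace M" by (rule charts_at_topspace[OF cp])
  have dp: "d \<in> charts_at p" unfolding d_def by (rule chart_at[OF pM])
  have c: "c \<in> A" "p \<in> fst c" and d: "d \<in> A" "p \<in> fst d" using cp dp by (auto simp: charts_at_iff)
  interpret D: local_metric "snd d ` fst d" "gloc d" by (rule local_metric_chart[OF d(1)])
  note l = vector_field_lift[OF d(1)]
  have "gram_matrix d p = D.gram (snd d p)"
    using d by (simp add: gram_matrix_def D.gram_def inner_vf_def coord_field_lift gloc_def)
  moreover have "ricci (coord_field d j) (coord_field d k) p = D.Ricci (snd d p) (axis j 1) (axis k 1)" for j k
    unfolding ricci_def Let_def d_def[symmetric] coord_field_lift D.Ricci_def
      riemann_chart[OF chart_openin[OF d(1)] l l l d(2) dp] lift_same[OF dp] ..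
  ultimately have "scalar_curvature p = D.Scal (snd d p)"
    unfolding scalar_curvature_def Let_def d_def[symmetric] D.Scal_def by simp
  also have "\<dots> = local_metric.Scal (gloc c) (snd c p)"
  proof -
    interpret local_isometry "snd c ` (fst c \<inter> (fst d \<inter> topspace M))" "snd d ` (fst d \<inter> (fst c \<inter> topspace M))"
      "gloc c" "gloc d" "transition c d"
      by (rule local_isometry_chart[OF c(1) d(1) openin_topspace])
    have "D.Scal (transition c d (snd c p)) = local_metric.Scal (gloc c) (snd c p)"
    proof (rule Scal_transform)
      show "snd c p \<in> snd c ` (fst c \<inter> (fst d \<inter> topspace M))" using c d pM by auto
      show "D.Curv (transition c d (snd c p)) (fderiv (transition c d) (snd c p) u) (fderiv (transition c d) (snd c p) v)
          (fderiv (transition c d) (snd c p) w) = fderiv (transition c d) (snd c p) (local_metric.Curv (gloc c) (snd c p) u v w)"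
        for u v w
        using Curv_transform[OF cp dp, of u v w] c by (simp add: transition_deriv_eq)
    qed
    then show ?thesis using c by simp
  qed
  finally show ?thesis .
qed

lemma scalar_curvature_smooth: "smooth_fun (topspace M) scalar_curvature"
  unfolding smooth_fun_def
proof
  fix c assume c: "c \<in> A"
  let ?V = "snd c ` (fst c \<inter> topspace M)"
  interpret local_metric ?V "gloc c" by (rule local_metric_chart_on[OF c openin_topspace])
  show "smooth_on ?V (scalar_curvature \<circ> chart_inv c)"
    by (rule smooth_on_cong[OF open_U Scal_smooth])
      (use scalar_curvature_chart[OF chart_point(1)[OF c]] chart_point(2)[OF c] in auto)
qed

text \<open>
  The description in the definition of the gradient is proper: the metric dual of the differential, formed
  in a chart, satisfies it, and nondegeneracy makes it unique.
\<close>

lemma gradient_tangent: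
  assumes f: "smooth_fun (topspace M) f" and p: "p \<in> topspace M"
  shows "gradient f p \<in> tangent_space p"
    and "v \<in> tangent_space p \<Longrightarrow> g p (gradient f p) v = dir_deriv p v f"
proof -
  define c where "c = chart_at p"
  have cp: "c \<in> charts_at p" unfolding c_def by (rule chart_at[OF p])
  then have c: "c \<in> A" "p \<in> fst c" by (auto simp: charts_at_iff)
  let ?V = "snd c ` (fst c \<inter> topspace M)"
  interpret local_metric ?V "gloc c" by (rule local_metric_chart_on[OF c(1) openin_topspace])
  have x: "snd c p \<in> ?V" using c p by auto
  have "smooth_on ?V (\<lambda>x. f (chart_inv c x))"
    using f c by (simp add: smooth_fun_def o_def)
  then have lin: "linear (fderiv (\<lambda>x. f (chart_inv c x)) (snd c p))"
    by (rule smooth_on_linear_fderiv[OF _ x])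
  define w where "w = lift c (sharp (snd c p) (fderiv (\<lambda>x. f (chart_inv c x)) (snd c p))) p"
  have w: "w \<in> tangent_space p" "\<forall>v\<in>tangent_space p. g p w v = dir_deriv p v f"
    unfolding w_def
    using lift_tangent[OF cp] gloc_eq[OF p cp] lift_same[OF cp] G_sharp[OF x lin]
      dir_deriv_chart[OF openin_topspace p f _ cp] by auto
  have "\<exists>!w. w \<in> tangent_space p \<and> (\<forall>v\<in>tangent_space p. g p w v = dir_deriv p v f)"
  proof (rule ex1I[of _ w])
    fix w' assume w': "w' \<in> tangent_space p \<and> (\<forall>v\<in>tangent_space p. g p w' v = dir_deriv p v f)"
    have "gloc c (snd c p) (w' c) u = gloc c (snd c p) (w c) u" for u
      using w w' lift_tangent[OF cp, of u] gloc_eq[OF p cp, of _ "lift c u p"] lift_same[OF cp, of u]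
      by metis
    then have "w' c = w c" by (rule G_eqI[OF x])
    then show "w' = w" using w w' cp tangent_eqI by blast
  qed (use w in blast)
  from theI'[OF this] show "gradient f p \<in> tangent_space p"
    "v \<in> tangent_space p \<Longrightarrow> g p (gradient f p) v = dir_deriv p v f"
    unfolding gradient_def by blast+
qed

text \<open>A function whose derivative vanishes is constant on balls in the charts, so that its level sets are
  open; a connected space is not the disjoint union of two nonempty open sets.\<close>

lemma constant_of_zero_derivative:
  assumes conn: "connected_space M" and f: "smooth_fun (topspace M) f"
    and zero: "\<And>p c u. c \<in> charts_at p \<Longrightarrow> fderiv (\<lambda>x. f (chart_inv c x)) (snd c p) u = 0"
  shows "\<exists>k. \<forall>p\<in>topspace M. f p = k"
proof (cases "topspace M = {}")
  case False
  then obtain p0 where p0: "p0 \<in> topspace M" by blast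
  have nbhd: "\<exists>W. openin M W \<and> p \<in> W \<and> (\<forall>q\<in>W. f q = f p)" if p: "p \<in> topspace M" for p
  proof -
    define c where "c = chart_at p"
    have "c \<in> charts_at p" unfolding c_def by (rule chart_at[OF p])
    then have c: "c \<in> A" "p \<in> fst c" by (auto simp: charts_at_iff)
    obtain e where e: "e > 0" "ball (snd c p) e \<subseteq> snd c ` fst c"
      using chart_open_image[OF c(1)] c(2) unfolding open_contains_ball by blast
    define W where "W = {q \<in> fst c. snd c q \<in> ball (snd c p) e}"
    have cont: "continuous_map (subtopology M (fst c)) euclidean (snd c)"
      using homeomorphic_imp_continuous_map[OF chart_homeomorphic[OF c(1)]]
      by (simp add: continuous_map_in_subtopology)
    have "openin (subtopology M (fst c)) {q \<in> topspace (subtopology M (fst c)). snd c q \<in> ball (snd c p) e}"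
      by (rule openin_continuous_map_preimage[OF cont]) simp
    then have "openin M W"
      unfolding W_def chart_topspace[OF c(1)]
      using openin_open_subtopology[OF chart_openin[OF c(1)]] by blast
    moreover have "p \<in> W" using c e by (simp add: W_def)
    moreover have "f q = f p" if "q \<in> W" for q
    proof -
      have sf: "smooth_on (snd c ` fst c) (\<lambda>x. f (chart_inv c x))"
        using f c openin_subset[OF chart_openin[OF c(1)]]
        by (auto simp: smooth_fun_def o_def Int_absorb2)
      have "((\<lambda>x. f (chart_inv c x)) has_derivative (\<lambda>h. 0)) (at x within ball (snd c p) e)"
        if "x \<in> ball (snd c p) e" for x
      proof -
        have x: "x \<in> snd c ` fst c" using that e by auto
        have "fderiv (\<lambda>x. f (chart_inv c x)) x = (\<lambda>h. 0)"
          using zero[OF chart_point'(1)[OF c(1) x]] chart_point'(2)[OF c(1) x] by (intro ext) simp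
        then show ?thesis
          using smooth_on_has_fderiv[OF sf x] by (simp add: has_derivative_at_withinI)
      qed
      from has_derivative_zero_unique[OF convex_ball this]
      have "f (chart_inv c (snd c q)) = f (chart_inv c (snd c p))"
        using that e by (simp add: W_def)
      then show ?thesis using that c by (simp add: W_def)
    qed
    ultimately show ?thesis by blast
  qed
  have op: "openin M {p \<in> topspace M. P (f p)}" for P
  proof (subst openin_subopen, safe)
    fix p assume p: "p \<in> topspace M" "P (f p)"
    obtain W where W: "openin M W" "p \<in> W" "\<forall>q\<in>W. f q = f p" using nbhd[OF p(1)] by blast
    have "W \<subseteq> {p \<in> topspace M. P (f p)}"
      using openin_subset[OF W(1)] W(3) p(2) by auto
    then show "\<exists>T. openin M T \<and> p \<in> T \<and> T \<subseteq> {p \<in> topspace M. P (f p)}"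
      using W(1,2) by blast
  qed
  have "{p \<in> topspace M. f p \<noteq> f p0} = {}"
  proof (rule ccontr)
    assume ne: "{p \<in> topspace M. f p \<noteq> f p0} \<noteq> {}"
    have "{p \<in> topspace M. f p = f p0} \<noteq> {}" using p0 by blast
    then show False
      using conn ne op[of "\<lambda>y. y = f p0"] op[of "\<lambda>y. y \<noteq> f p0"]
      unfolding connected_space_def by blast
  qed
  then show ?thesis by blast
qed auto

end

section \<open>Yamabe solitons of constant type\<close>

context yamabe_soliton
begin

lemma fderiv_scalar_curvature:
  assumes type: "phi_analytic_of_type k" and cp: "c \<in> charts_at p"
  shows "fderiv (\<lambda>x. scalar_curvature (chart_inv c x)) (snd c p) u = k * gloc c (snd c p) (\<xi> p c) u"
proof -
  have pM: "p \<in> topspace M" by (rule charts_at_topspace[OF cp])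
  note R = scalar_curvature_smooth
  have xi: "\<xi> p \<in> tangent_space p" by (rule vector_field_tangent[OF soliton_field pM])
  have grad: "gradient scalar_curvature p = (\<lambda>c. k *\<^sub>R \<xi> p c)"
    using type pM by (simp add: phi_analytic_of_type_def)
  have "fderiv (\<lambda>x. scalar_curvature (chart_inv c x)) (snd c p) u
      = dir_deriv p (lift c u p) scalar_curvature"
    by (simp add: dir_deriv_chart[OF openin_topspace pM R lift_tangent[OF cp] cp] lift_same[OF cp])
  also have "\<dots> = g p (\<lambda>c. k *\<^sub>R \<xi> p c) (lift c u p)"
    using gradient_tangent(2)[OF R pM lift_tangent[OF cp]] by (simp add: grad)
  also have "\<dots> = k * g p (\<xi> p) (lift c u p)"
    using metric_linear[OF pM xi xi lift_tangent[OF cp], of k 0] by simp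
  also have "g p (\<xi> p) (lift c u p) = gloc c (snd c p) (\<xi> p c) u"
    by (simp add: gloc_eq[OF pM cp xi lift_tangent[OF cp]] lift_same[OF cp])
  finally show ?thesis .
qed

text \<open>
  The lifts of \<open>u\<close> and \<open>v\<close> have constant columns in the chart \<open>c\<close>, so that in \<open>L\<^sub>\<xi> g\<close> their brackets with
  \<open>\<xi>\<close> are derivatives of \<open>\<xi>\<close> alone.
\<close>

lemma soliton_eq_chart:
  assumes cp: "c \<in> charts_at p"
  shows "fderiv (\<lambda>y. gloc c y u v) (snd c p) (\<xi> p c)
      + gloc c (snd c p) (fderiv (loc c \<xi>) (snd c p) u) v
      + gloc c (snd c p) u (fderiv (loc c \<xi>) (snd c p) v)
    = 2 * (scalar_curvature p - lam) * gloc c (snd c p) u v"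
proof -
  have c: "c \<in> A" "p \<in> fst c" using cp by (auto simp: charts_at_iff)
  have pM: "p \<in> topspace M" by (rule charts_at_topspace[OF cp])
  note W = chart_openin[OF c(1)] and l = vector_field_lift[OF c(1)]
  interpret local_metric "snd c ` fst c" "gloc c" by (rule local_metric_chart[OF c(1)])
  have x: "snd c p \<in> snd c ` fst c" using c by auto
  have xi: "vector_field (fst c) \<xi>"
    using vector_field_subset[OF soliton_field] openin_subset[OF W] by blast
  have bracket: "lie_bracket \<xi> (lift c u) p \<in> tangent_space p"
    "lie_bracket \<xi> (lift c u) p c = - fderiv (loc c \<xi>) (snd c p) u" for u
  proof -
    show "lie_bracket \<xi> (lift c u) p \<in> tangent_space p"
      by (rule vector_field_tangent[OF vector_field_lie_bracket[OF W xi l] c(2)])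
    \<comment> \<open>In its own chart the lifted field is constant.\<close>
    have "fderiv (loc c (lift c u)) (snd c p) = fderiv (\<lambda>x. u) (snd c p)"
      by (rule fderiv_cong[OF open_U _ x, symmetric])
        (use c in \<open>auto simp: smooth_on_const open_U lift_same charts_at_iff\<close>)
    then show "lie_bracket \<xi> (lift c u) p c = - fderiv (loc c \<xi>) (snd c p) u"
      by (simp add: lie_bracket_def cp lift_same)
  qed
  have inner: "inner_vf (lift c u) (lift c v) (chart_inv c x) = gloc c x u v" for x
    by (simp add: inner_vf_def gloc_def)
  have "vf_apply \<xi> (inner_vf (lift c u) (lift c v)) p = fderiv (\<lambda>y. gloc c y u v) (snd c p) (\<xi> p c)"
    unfolding vf_apply_def inner[symmetric]
    by (rule dir_deriv_chart[OF W c(2) _ vector_field_tangent[OF xi c(2)] cp])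
      (use metric_smooth[OF W l l] in \<open>simp add: inner_vf_def[abs_def]\<close>)
  moreover have "inner_vf (lie_bracket \<xi> (lift c u)) (lift c v) p = - gloc c (snd c p) (fderiv (loc c \<xi>) (snd c p) u) v"
    by (simp add: inner_vf_def gloc_eq[OF pM cp bracket(1) lift_tangent[OF cp]] bracket(2)
        lift_same[OF cp] G_simps x)
  moreover have "inner_vf (lift c u) (lie_bracket \<xi> (lift c v)) p = - gloc c (snd c p) u (fderiv (loc c \<xi>) (snd c p) v)"
    by (simp add: inner_vf_def gloc_eq[OF pM cp lift_tangent[OF cp] bracket(1)] bracket(2)
        lift_same[OF cp] G_simps x)
  moreover have "inner_vf (lift c u) (lift c v) p = gloc c (snd c p) u v"
    using inner[of "snd c p"] c by simp
  ultimately show ?thesis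
    using soliton_eq[OF W l l c(2), of u v] by (simp add: lie_deriv_metric_def)
qed

text \<open>Both sides are the derivative of the scalar curvature along the soliton field.\<close>

lemma scalar_curvature_identity:
  assumes type: "phi_analytic_of_type k" and k: "k \<noteq> 0" and cp: "c \<in> charts_at p"
  shows "k * gloc c (snd c p) (\<xi> p c) (\<xi> p c) =
    - 2 * (scalar_curvature p - lam) * (scalar_curvature p + real CARD('n) * (real CARD('n) - 1) * k)"
proof -
  have c: "c \<in> A" "p \<in> fst c" using cp by (auto simp: charts_at_iff)
  let ?U = "snd c ` fst c"
  interpret local_metric ?U "gloc c" by (rule local_metric_chart[OF c(1)])
  have R: "scalar_curvature (chart_inv c x) = Scal x" if "x \<in> ?U" for x
    using scalar_curvature_chart[OF chart_point'(1)[OF c(1) that]] chart_point'(2)[OF c(1) that] by simp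
  have dR: "fderiv Scal x u = k * gloc c x (loc c \<xi> x) u" if x: "x \<in> ?U" for x u
    using fderiv_scalar_curvature[OF type chart_point'(1)[OF c(1) x], of u]
      fderiv_cong[OF open_U Scal_smooth x R[symmetric]]
    by (simp add: chart_point'(2)[OF c(1) x])
  have df: "fderiv (\<lambda>x. Scal x - lam) x u = fderiv Scal x u" if x: "x \<in> ?U" for x u
    by (simp add: fderiv_diff[OF Scal_smooth smooth_on_const[OF open_U] x])
  interpret local_soliton ?U "gloc c" "loc c \<xi>" "\<lambda>x. Scal x - lam" k
  proof
    show "smooth_on ?U (loc c \<xi>)"
      by (rule smooth_on_subset[OF vector_field_smooth[OF soliton_field c(1)]])
        (use openin_subset[OF chart_openin[OF c(1)]] in auto)
    show "smooth_on ?U (\<lambda>x. Scal x - lam)"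
      by (intro smooth_on_diff open_U Scal_smooth smooth_on_const)
    show "fderiv (\<lambda>x. Scal x - lam) x u = k * gloc c x (loc c \<xi> x) u" if "x \<in> ?U" for x u
      by (simp add: df[OF that] dR[OF that])
    show "fderiv (\<lambda>y. gloc c y u v) x (loc c \<xi> x) + gloc c x (fderiv (loc c \<xi>) x u) v
       + gloc c x u (fderiv (loc c \<xi>) x v) = 2 * (Scal x - lam) * gloc c x u v" if "x \<in> ?U" for x u v
      using soliton_eq_chart[OF chart_point'(1)[OF c(1) that], of u v]
      by (simp add: chart_point'(2)[OF c(1) that] R[OF that])
  qed (rule k)
  have x: "snd c p \<in> ?U" using c by auto
  show ?thesis
    using dScal_xi[OF x] dR[OF x, of "\<xi> p c"] R[OF x] c by simp
qed

end

theorem theorem3p3: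
  fixes M :: "'a topology"
    and A :: "('a, 'n::finite) chart set"
    and g :: "'a \<Rightarrow> ('a, 'n) tvec \<Rightarrow> ('a, 'n) tvec \<Rightarrow> real"
    and \<xi> :: "('a, 'n) vfield"
    and lam c :: real
  assumes "yamabe_soliton M A g \<xi> lam"
    and "yamabe_soliton.phi_analytic_of_type M A g \<xi> c"
    and "c < 0"
    and "\<And>p. p \<in> topspace M \<Longrightarrow>
      lam \<le> riemannian_manifold.scalar_curvature M A g p \<and>
      riemannian_manifold.scalar_curvature M A g p \<le>
        - real CARD('n) * (real CARD('n) - 1) * c"
  shows "riemannian_manifold.yamabe_metric M A g"
proof -
  interpret yamabe_soliton M A g \<xi> lam by (rule assms(1))
  have "fderiv (\<lambda>x. scalar_curvature (chart_inv d x)) (snd d p) u = 0" if dp: "d \<in> charts_at p" for p d u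
  proof -
    have d: "d \<in> A" "p \<in> fst d" using dp by (auto simp: charts_at_iff)
    interpret local_metric "snd d ` fst d" "gloc d" by (rule local_metric_chart[OF d(1)])
    have x: "snd d p \<in> snd d ` fst d" using d by auto
    have "0 \<le> - 2 * (scalar_curvature p - lam) * (scalar_curvature p + real CARD('n) * (real CARD('n) - 1) * c)"
      using assms(4)[OF charts_at_topspace[OF dp]] by (intro mult_nonpos_nonpos) auto
    then have "0 \<le> c * gloc d (snd d p) (\<xi> p d) (\<xi> p d)"
      unfolding scalar_curvature_identity[OF assms(2) less_imp_neq[OF assms(3)] dp] .
    then have "gloc d (snd d p) (\<xi> p d) (\<xi> p d) \<le> 0"
      using assms(3) by (simp add: zero_le_mult_iff)
    then have "\<xi> p d = 0"
      using G_pos[OF x, of "\<xi> p d"] by force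
    then show ?thesis
      by (simp add: fderiv_scalar_curvature[OF assms(2) dp] bilinear_lzero[OF G_bilinear[OF x]])
  qed
  from constant_of_zero_derivative[OF connected scalar_curvature_smooth this]
  show ?thesis unfolding yamabe_metric_def .
qed

end
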